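(* Let $k$ be a field of characteristic $0$, let $\varphi\neq\mathrm{id}_k$ be an automorphism of $k$, and let $\lambda\in k$ be such that $\varphi(\lambda)\neq\lambda$. Let $\Theta$ be the variety of all representations of Lie algebras over $k$ over $k$-linear spaces, and let $F=F(x_1^{(1)},x_2^{(1)},x^{(2)})$ be the free representation with free generators $x_1=x_1^{(1)}$, $x_2=x_2^{(1)}$ of the Lie algebra sort and $x^{(2)}$ of the vector sort. Let $A=A(x_1,x_2)$ be the free associative $k$-algebra with unit on $x_1,x_2$, $N=\langle x_1,x_2\rangle$ its two-sided ideal generated by $x_1,x_2$, and put $$e_2=[x_1,[x_1,[[x_1,x_2],x_2]]],\qquad e_4=[[x_1,[x_1,x_2]],[x_1,x_2]],\qquad t=\lambda e_2+e_4,$$ considered as elements of $A$. Let $I$ be the two-sided ideal of $A$ generated by $t$ and $N^6$. Let $T$ be the congruence of $F$ corresponding to the subrepresentation $Q$ with $Q^{(1)}=\{0\}$, $Q^{(2)}=I\circ x^{(2)}$, and let $H=F/T$. Let $H_W^*$ be the representation with the same underlying sets as $H$ and the same operations, except that in each of the two sorts, for every $\mu\in k$, the operation of multiplication by the scalar $\mu$ in $H_W^*$ is $h\mapsto\varphi(\mu)h$ (computed in $H$). Then the representations $H$ and $H_W^*$ are not geometrically equivalent.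
   Context: A representation of a Lie algebra over a $k$-linear space is a two-sorted algebra $H$ with sorts $\{1,2\}$: $H^{(1)}$ is a Lie algebra over $k$, $H^{(2)}$ is a $k$-linear space, and there is a $k$-bilinear operation $\circ$ of type $(1,2;2)$ with $[l_1,l_2]\circ v=l_1\circ(l_2\circ v)-l_2\circ(l_1\circ v)$. The signature consists of zero, negation, addition and, for each $\mu\in k$, multiplication by the scalar $\mu$, in each of the two sorts; the Lie bracket; and $\circ$. A homomorphism is a pair consisting of a homomorphism of Lie algebras over $k$ and a $k$-linear map compatible with the actions. Let $X_0$ be a two-sorted set with countably infinitely many elements of each sort. The objects of $\Theta^0$ are the free algebras $F(X)$ of $\Theta$ with $X\subset X_0$ finite: if $X^{(i)}$ is the set of elements of $X$ of sort $i$, then $F(X)^{(1)}=L(X^{(1)})$ is the free Lie algebra over $k$ on $X^{(1)}$ (contained in the free associative $k$-algebra with unit $A(X^{(1)})$) and $F(X)^{(2)}=A(X^{(1)})\circ X^{(2)}$ is the free left $A(X^{(1)})$-module with basis $X^{(2)}$, where $(x_{i_1}\cdots x_{i_n})\circ v=x_{i_1}\circ(\cdots\circ(x_{i_n}\circ v))$. A congruence of $F(X)$ corresponds to a subrepresentation $Q$ such that $Q^{(1)}$ is an ideal of $L(X^{(1)})$, $Q^{(2)}$ is an $A(X^{(1)})$-submodule of $F(X)^{(2)}$ and $l\circ v\in Q^{(2)}$ for all $l\in Q^{(1)}$, $v\in F(X)^{(2)}$; two elements of sort $i$ are congruent if and only if their difference lies in $Q^{(i)}$. For $F\in\mathrm{Ob}\,\Theta^0$,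 $H\in\Theta$ and $T\subseteq(F^{(1)})^2\cup(F^{(2)})^2$ put $T_H''=\bigcap\{\ker\psi\mid\psi\in\mathrm{Hom}(F,H),\ T\subseteq\ker\psi\}$, where $\ker\psi=\{(a,b)\mid\psi(a)=\psi(b)\}$, regarded as a subset of $(F^{(1)})^2\cup(F^{(2)})^2$. Algebras $H_1,H_2\in\Theta$ are geometrically equivalent if $T_{H_1}''=T_{H_2}''$ for every $F\in\mathrm{Ob}\,\Theta^0$ and every $T\subseteq(F^{(1)})^2\cup(F^{(2)})^2$. *)

theory Defs
  imports "HOL-Library.Poly_Mapping" "HOL-Algebra.Ideal_Product"
begin

section \<open>Representations of Lie algebras over linear spaces\<close>

record ('k, 'a) linear_space = "'a partial_object" +
  lzero :: 'a
  lneg :: "'a \<Rightarrow> 'a"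
  ladd :: "'a \<Rightarrow> 'a \<Rightarrow> 'a"
  lscale :: "'k \<Rightarrow> 'a \<Rightarrow> 'a"

record ('k, 'a) lie_algebra = "('k, 'a) linear_space" +
  bracket :: "'a \<Rightarrow> 'a \<Rightarrow> 'a"

record ('k, 'l, 'v) lie_rep =
  lie :: "('k, 'l) lie_algebra"
  vec :: "('k, 'v) linear_space"
  act :: "'l \<Rightarrow> 'v \<Rightarrow> 'v"

locale linear_space =
  fixes V :: "('k::field, 'a, 'm) linear_space_scheme"
  assumes zero_closed: "lzero V \<in> carrier V"
    and neg_closed: "x \<in> carrier V \<Longrightarrow> lneg V x \<in> carrier V"
    and add_closed: "\<lbrakk>x \<in> carrier V; y \<in> carrier V\<rbrakk> \<Longrightarrow> ladd V x y \<in> carrier V"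
    and scale_closed: "x \<in> carrier V \<Longrightarrow> lscale V c x \<in> carrier V"
    and add_assoc: "\<lbrakk>x \<in> carrier V; y \<in> carrier V; z \<in> carrier V\<rbrakk>
      \<Longrightarrow> ladd V (ladd V x y) z = ladd V x (ladd V y z)"
    and add_comm: "\<lbrakk>x \<in> carrier V; y \<in> carrier V\<rbrakk> \<Longrightarrow> ladd V x y = ladd V y x"
    and add_zero: "x \<in> carrier V \<Longrightarrow> ladd V x (lzero V) = x"
    and add_neg: "x \<in> carrier V \<Longrightarrow> ladd V x (lneg V x) = lzero V"
    and scale_add: "\<lbrakk>x \<in> carrier V; y \<in> carrier V\<rbrakk>
      \<Longrightarrow> lscale V c (ladd V x y) = ladd V (lscale V c x) (lscale V c y)"
    and add_scale: "x \<in> carrier V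
      \<Longrightarrow> lscale V (c + d) x = ladd V (lscale V c x) (lscale V d x)"
    and scale_scale: "x \<in> carrier V \<Longrightarrow> lscale V c (lscale V d x) = lscale V (c * d) x"
    and scale_one: "x \<in> carrier V \<Longrightarrow> lscale V 1 x = x"

locale lie_algebra = linear_space L
  for L :: "('k::field, 'l, 'm) lie_algebra_scheme" +
  assumes bracket_closed: "\<lbrakk>x \<in> carrier L; y \<in> carrier L\<rbrakk> \<Longrightarrow> bracket L x y \<in> carrier L"
    and bracket_add_left: "\<lbrakk>x \<in> carrier L; y \<in> carrier L; z \<in> carrier L\<rbrakk>
      \<Longrightarrow> bracket L (ladd L x y) z = ladd L (bracket L x z) (bracket L y z)"
    and bracket_add_right: "\<lbrakk>x \<in> carrier L; y \<in> carrier L; z \<in> carrier L\<rbrakk>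
      \<Longrightarrow> bracket L x (ladd L y z) = ladd L (bracket L x y) (bracket L x z)"
    and bracket_scale_left: "\<lbrakk>x \<in> carrier L; y \<in> carrier L\<rbrakk>
      \<Longrightarrow> bracket L (lscale L c x) y = lscale L c (bracket L x y)"
    and bracket_scale_right: "\<lbrakk>x \<in> carrier L; y \<in> carrier L\<rbrakk>
      \<Longrightarrow> bracket L x (lscale L c y) = lscale L c (bracket L x y)"
    and bracket_self: "x \<in> carrier L \<Longrightarrow> bracket L x x = lzero L"
    and jacobi: "\<lbrakk>x \<in> carrier L; y \<in> carrier L; z \<in> carrier L\<rbrakk>
      \<Longrightarrow> ladd L (bracket L x (bracket L y z))
            (ladd L (bracket L y (bracket L z x)) (bracket L z (bracket L x y))) = lzero L"

locale lie_rep =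
  fixes H :: "('k::field, 'l, 'v, 'm) lie_rep_scheme"
  assumes lie: "lie_algebra (lie H)"
    and vec: "linear_space (vec H)"
    and act_closed: "\<lbrakk>a \<in> carrier (lie H); v \<in> carrier (vec H)\<rbrakk> \<Longrightarrow> act H a v \<in> carrier (vec H)"
    and act_add_left: "\<lbrakk>a \<in> carrier (lie H); b \<in> carrier (lie H); v \<in> carrier (vec H)\<rbrakk>
      \<Longrightarrow> act H (ladd (lie H) a b) v = ladd (vec H) (act H a v) (act H b v)"
    and act_add_right: "\<lbrakk>a \<in> carrier (lie H); v \<in> carrier (vec H); w \<in> carrier (vec H)\<rbrakk>
      \<Longrightarrow> act H a (ladd (vec H) v w) = ladd (vec H) (act H a v) (act H a w)"
    and act_scale_left: "\<lbrakk>a \<in> carrier (lie H); v \<in> carrier (vec H)\<rbrakk>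
      \<Longrightarrow> act H (lscale (lie H) c a) v = lscale (vec H) c (act H a v)"
    and act_scale_right: "\<lbrakk>a \<in> carrier (lie H); v \<in> carrier (vec H)\<rbrakk>
      \<Longrightarrow> act H a (lscale (vec H) c v) = lscale (vec H) c (act H a v)"
    and act_bracket: "\<lbrakk>a \<in> carrier (lie H); b \<in> carrier (lie H); v \<in> carrier (vec H)\<rbrakk>
      \<Longrightarrow> act H (bracket (lie H) a b) v
          = ladd (vec H) (act H a (act H b v)) (lneg (vec H) (act H b (act H a v)))"

definition linear_hom ::
  "('k, 'a, 'm) linear_space_scheme \<Rightarrow> ('k, 'b, 'n) linear_space_scheme \<Rightarrow> ('a \<Rightarrow> 'b) set" where
  "linear_hom V W = {f \<in> carrier V \<rightarrow> carrier W.
     f (lzero V) = lzero W \<and>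
     (\<forall>a\<in>carrier V. f (lneg V a) = lneg W (f a)) \<and>
     (\<forall>a\<in>carrier V. \<forall>b\<in>carrier V. f (ladd V a b) = ladd W (f a) (f b)) \<and>
     (\<forall>c. \<forall>a\<in>carrier V. f (lscale V c a) = lscale W c (f a))}"

definition lie_hom ::
  "('k, 'a, 'm) lie_algebra_scheme \<Rightarrow> ('k, 'b, 'n) lie_algebra_scheme \<Rightarrow> ('a \<Rightarrow> 'b) set" where
  "lie_hom L M = {f \<in> linear_hom L M.
     \<forall>a\<in>carrier L. \<forall>b\<in>carrier L. f (bracket L a b) = bracket M (f a) (f b)}"

definition rep_hom ::
  "('k, 'l, 'v, 'm) lie_rep_scheme \<Rightarrow> ('k, 'l2, 'v2, 'n) lie_rep_scheme
     \<Rightarrow> (('l \<Rightarrow> 'l2) \<times> ('v \<Rightarrow> 'v2)) set" where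
  "rep_hom F H = {(f, g). f \<in> lie_hom (lie F) (lie H) \<and> g \<in> linear_hom (vec F) (vec H) \<and>
     (\<forall>a\<in>carrier (lie F). \<forall>v\<in>carrier (vec F). g (act F a v) = act H (f a) (g v))}"


section \<open>Geometric equivalence\<close>

text \<open>A subset of the disjoint union of the squares of the two sorts is a set of type
  \<^typ>\<open>('l \<times> 'l + 'v \<times> 'v) set\<close>.\<close>

definition sort_squares ::
  "('k, 'l, 'v, 'm) lie_rep_scheme \<Rightarrow> ('l \<times> 'l + 'v \<times> 'v) set" where
  "sort_squares F = Inl ` (carrier (lie F) \<times> carrier (lie F))
     \<union> Inr ` (carrier (vec F) \<times> carrier (vec F))"

definition hom_kernel ::
  "('k, 'l, 'v, 'm) lie_rep_scheme \<Rightarrow> ('l \<Rightarrow> 'l2) \<times> ('v \<Rightarrow> 'v2)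
     \<Rightarrow> ('l \<times> 'l + 'v \<times> 'v) set" where
  "hom_kernel F \<psi> =
     Inl ` {(a, b). a \<in> carrier (lie F) \<and> b \<in> carrier (lie F) \<and> fst \<psi> a = fst \<psi> b}
     \<union> Inr ` {(u, v). u \<in> carrier (vec F) \<and> v \<in> carrier (vec F) \<and> snd \<psi> u = snd \<psi> v}"

text \<open>The intersection is never over the empty family: the zero homomorphism
  has kernel \<^term>\<open>sort_squares F\<close>.\<close>

definition alg_closure ::
  "('k, 'l, 'v, 'm) lie_rep_scheme \<Rightarrow> ('k, 'l2, 'v2, 'n) lie_rep_scheme
     \<Rightarrow> ('l \<times> 'l + 'v \<times> 'v) set \<Rightarrow> ('l \<times> 'l + 'v \<times> 'v) set" where
  "alg_closure F H T = \<Inter>{hom_kernel F \<psi> |\<psi>. \<psi> \<in> rep_hom F H \<and> T \<subseteq> hom_kernel F \<psi>}"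


section \<open>Free representations\<close>

text \<open>Words are lists; with concatenation as addition they form the free monoid, so that
  \<^typ>\<open>'x list \<Rightarrow>\<^sub>0 'k\<close> with the convolution product of \<^theory>\<open>HOL-Library.Poly_Mapping\<close>
  is the free associative algebra with unit.\<close>

instantiation list :: (type) monoid_add
begin
definition zero_list :: "'a list" where "zero_list = []"
definition plus_list :: "'a list \<Rightarrow> 'a list \<Rightarrow> 'a list" where "plus_list = append"
instance by standard (simp_all add: zero_list_def plus_list_def)
end

type_synonym 'k assoc = "nat list \<Rightarrow>\<^sub>0 'k"

definition assoc_algebra :: "nat set \<Rightarrow> ('k::field assoc) ring" where
  "assoc_algebra X = \<lparr>carrier = {p. Poly_Mapping.keys p \<subseteq> lists X},
     mult = (*), one = 1, zero = 0, add = (+)\<rparr>"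

definition gen :: "nat \<Rightarrow> 'k::field assoc" where
  "gen i = Poly_Mapping.single [i] 1"

definition scal :: "'k::field \<Rightarrow> 'k assoc \<Rightarrow> 'k assoc" where
  "scal c p = Poly_Mapping.map ((*) c) p"

definition commutator :: "'k::field assoc \<Rightarrow> 'k assoc \<Rightarrow> 'k assoc" where
  "commutator a b = a * b - b * a"

text \<open>The free Lie algebra on \<open>X\<close>, realised (Witt) as the Lie subalgebra of the free
  associative algebra generated by \<open>X\<close>.\<close>

inductive_set free_lie_carrier :: "nat set \<Rightarrow> ('k::field assoc) set" for X where
  gen: "i \<in> X \<Longrightarrow> gen i \<in> free_lie_carrier X"
| zero: "0 \<in> free_lie_carrier X"
| add: "\<lbrakk>a \<in> free_lie_carrier X; b \<in> free_lie_carrier X\<rbrakk> \<Longrightarrow> a + b \<in> free_lie_carrier X"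
| scal: "a \<in> free_lie_carrier X \<Longrightarrow> scal c a \<in> free_lie_carrier X"
| commutator: "\<lbrakk>a \<in> free_lie_carrier X; b \<in> free_lie_carrier X\<rbrakk>
    \<Longrightarrow> commutator a b \<in> free_lie_carrier X"

definition free_lie :: "nat set \<Rightarrow> ('k::field, 'k assoc) lie_algebra" where
  "free_lie X = \<lparr>carrier = free_lie_carrier X, lzero = 0, lneg = uminus, ladd = (+),
     lscale = scal, bracket = commutator\<rparr>"

text \<open>The free left module with basis \<open>Y\<close>: an element is given by its finitely supported
  family of coordinates, which lie in the free associative algebra on \<open>X\<close>.\<close>

definition free_module :: "nat set \<Rightarrow> nat set \<Rightarrow> ('k::field, nat \<Rightarrow>\<^sub>0 'k assoc) linear_space" where
  "free_module X Y = \<lparr>carrier = {v. Poly_Mapping.keys v \<subseteq> Y \<and>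
       (\<forall>y. Poly_Mapping.lookup v y \<in> carrier (assoc_algebra X))},
     lzero = 0, lneg = uminus, ladd = (+), lscale = (\<lambda>c. Poly_Mapping.map (scal c))\<rparr>"

definition module_act :: "'k::field assoc \<Rightarrow> (nat \<Rightarrow>\<^sub>0 'k assoc) \<Rightarrow> (nat \<Rightarrow>\<^sub>0 'k assoc)" where
  "module_act a v = Poly_Mapping.map ((*) a) v"

definition free_rep ::
  "nat set \<Rightarrow> nat set \<Rightarrow> ('k::field, 'k assoc, nat \<Rightarrow>\<^sub>0 'k assoc) lie_rep" where
  "free_rep X Y = \<lparr>lie = free_lie X, vec = free_module X Y, act = module_act\<rparr>"

text \<open>The two-sorted set of all variables is \<open>\<nat>\<close> in each sort.\<close>

definition geometrically_equivalent ::
  "('k::field, 'l, 'v, 'm) lie_rep_scheme \<Rightarrow> ('k, 'l2, 'v2, 'n) lie_rep_scheme \<Rightarrow> bool" where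
  "geometrically_equivalent H1 H2 \<longleftrightarrow>
     (\<forall>X Y T. finite X \<longrightarrow> finite Y \<longrightarrow> T \<subseteq> sort_squares (free_rep X Y) \<longrightarrow>
        alg_closure (free_rep X Y) H1 T = alg_closure (free_rep X Y) H2 T)"


section \<open>Congruences and quotients\<close>

definition congruence_of ::
  "('k, 'l, 'v, 'm) lie_rep_scheme \<Rightarrow> 'l set \<times> 'v set \<Rightarrow> ('l \<times> 'l + 'v \<times> 'v) set" where
  "congruence_of F Q =
     Inl ` {(a, b). a \<in> carrier (lie F) \<and> b \<in> carrier (lie F) \<and>
              ladd (lie F) a (lneg (lie F) b) \<in> fst Q}
     \<union> Inr ` {(u, v). u \<in> carrier (vec F) \<and> v \<in> carrier (vec F) \<and>
              ladd (vec F) u (lneg (vec F) v) \<in> snd Q}"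

definition linear_quot ::
  "('k, 'a, 'm) linear_space_scheme \<Rightarrow> ('a \<times> 'a) set \<Rightarrow> ('k, 'a set) linear_space" where
  "linear_quot V R = \<lparr>carrier = carrier V // R,
     lzero = R `` {lzero V},
     lneg = (\<lambda>C. \<Union>a\<in>C. R `` {lneg V a}),
     ladd = (\<lambda>C D. \<Union>a\<in>C. \<Union>b\<in>D. R `` {ladd V a b}),
     lscale = (\<lambda>c C. \<Union>a\<in>C. R `` {lscale V c a})\<rparr>"

definition lie_quot ::
  "('k, 'a, 'm) lie_algebra_scheme \<Rightarrow> ('a \<times> 'a) set \<Rightarrow> ('k, 'a set) lie_algebra" where
  "lie_quot L R = linear_space.extend (linear_quot L R)
     (lie_algebra.fields (\<lambda>C D. \<Union>a\<in>C. \<Union>b\<in>D. R `` {bracket L a b}))"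

definition rep_quot ::
  "('k, 'l, 'v, 'm) lie_rep_scheme \<Rightarrow> ('l \<times> 'l + 'v \<times> 'v) set
     \<Rightarrow> ('k, 'l set, 'v set) lie_rep" where
  "rep_quot F T = \<lparr>lie = lie_quot (lie F) (Inl -` T), vec = linear_quot (vec F) (Inr -` T),
     act = (\<lambda>C D. \<Union>a\<in>C. \<Union>v\<in>D. (Inr -` T) `` {act F a v})\<rparr>"


section \<open>The twisted representation\<close>

definition field_automorphism :: "('k::field \<Rightarrow> 'k) \<Rightarrow> bool" where
  "field_automorphism \<phi> \<longleftrightarrow> bij \<phi> \<and> \<phi> 1 = 1 \<and>
     (\<forall>a b. \<phi> (a + b) = \<phi> a + \<phi> b) \<and> (\<forall>a b. \<phi> (a * b) = \<phi> a * \<phi> b)"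

definition twist ::
  "('k \<Rightarrow> 'k) \<Rightarrow> ('k, 'l, 'v) lie_rep \<Rightarrow> ('k, 'l, 'v) lie_rep" where
  "twist \<phi> H = H\<lparr>lie := (lie H)\<lparr>lscale := \<lambda>\<mu>. lscale (lie H) (\<phi> \<mu>)\<rparr>,
     vec := (vec H)\<lparr>lscale := \<lambda>\<mu>. lscale (vec H) (\<phi> \<mu>)\<rparr>\<rparr>"


section \<open>The representation \<open>H\<close>\<close>

abbreviation x1 :: "'k::field assoc" where "x1 \<equiv> gen 1"
abbreviation x2 :: "'k::field assoc" where "x2 \<equiv> gen 2"

definition e2 :: "'k::field assoc" where
  "e2 = commutator x1 (commutator x1 (commutator (commutator x1 x2) x2))"

definition e4 :: "'k::field assoc" where
  "e4 = commutator (commutator x1 (commutator x1 x2)) (commutator x1 x2)"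

definition t_elem :: "'k::field \<Rightarrow> 'k assoc" where
  "t_elem lam = scal lam e2 + e4"

abbreviation assoc_A :: "('k::field assoc) ring" where "assoc_A \<equiv> assoc_algebra {1, 2}"

definition ideal_N :: "('k::field assoc) set" where
  "ideal_N = genideal assoc_A {x1, x2}"

definition ideal_I :: "'k::field \<Rightarrow> ('k assoc) set" where
  "ideal_I lam = genideal assoc_A ({t_elem lam} \<union> ideal_N [^]\<^bsub>ideals_set assoc_A\<^esub> (6::nat))"

definition F_rep :: "('k::field, 'k assoc, nat \<Rightarrow>\<^sub>0 'k assoc) lie_rep" where
  "F_rep = free_rep {1, 2} {1}"

definition x_vec :: "nat \<Rightarrow>\<^sub>0 'k::field assoc" where
  "x_vec = Poly_Mapping.single 1 1"

definition Q_sub :: "'k::field \<Rightarrow> 'k assoc set \<times> (nat \<Rightarrow>\<^sub>0 'k assoc) set" where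
  "Q_sub lam = ({0}, (\<lambda>a. module_act a x_vec) ` ideal_I lam)"

definition H_rep ::
  "'k::field \<Rightarrow> ('k, 'k assoc set, (nat \<Rightarrow>\<^sub>0 'k assoc) set) lie_rep" where
  "H_rep lam = rep_quot F_rep (congruence_of F_rep (Q_sub lam))"

section \<open>The algebras involved are representations\<close>

lemma poly_mapping_sum_single:
  "p = (\<Sum>k\<in>Poly_Mapping.keys p. Poly_Mapping.single k (Poly_Mapping.lookup p k))"
proof (rule poly_mapping_eqI)
  fix j
  show "Poly_Mapping.lookup p j =
    Poly_Mapping.lookup (\<Sum>k\<in>Poly_Mapping.keys p. Poly_Mapping.single k (Poly_Mapping.lookup p k)) j"
    by (simp add: lookup_sum lookup_single when_def in_keys_iff)
qed

lemma single_zero_commute: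
  fixes p :: "'k::field assoc"
  shows "p * Poly_Mapping.single 0 c = Poly_Mapping.single 0 c * p"
proof -
  let ?s = "\<lambda>k. Poly_Mapping.single k (Poly_Mapping.lookup p k)"
  have "(\<Sum>k\<in>Poly_Mapping.keys p. ?s k) * Poly_Mapping.single 0 c
      = Poly_Mapping.single 0 c * (\<Sum>k\<in>Poly_Mapping.keys p. ?s k)"
    by (simp add: sum_distrib_left sum_distrib_right mult_single mult.commute)
  then show ?thesis using poly_mapping_sum_single[of p] by simp
qed

lemma scal_conv_mult: "scal c p = Poly_Mapping.single 0 c * p"
  by (simp add: scal_def mult_map_scale_conv_mult)

lemma scal_zero [simp]: "scal c 0 = 0"
  by (simp add: scal_conv_mult)

lemma mult_scal: "a * scal c b = scal c (a * b)"
  by (metis scal_conv_mult mult.assoc single_zero_commute)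

lemma scal_mult: "scal c a * b = scal c (a * b)"
  by (simp add: scal_conv_mult mult.assoc)

lemma scal_add: "scal c (a + b) = scal c a + scal c b"
  by (simp add: scal_conv_mult distrib_left)

lemma scal_diff: "scal c (a - b) = scal c a - scal c b"
  by (simp add: scal_conv_mult right_diff_distrib)

lemma add_scal: "scal (c + d) a = scal c a + scal d a"
  by (simp add: scal_conv_mult distrib_right single_add)

lemma scal_scal: "scal c (scal d a) = scal (c * d) a"
  by (simp add: scal_conv_mult mult_single flip: mult.assoc)

lemma scal_one: "scal 1 a = a"
  by (simp add: scal_conv_mult)

lemma scal_minus_one: "scal (- 1) a = - a"
  using add_scal[of 1 "- 1" a] by (simp add: scal_one scal_conv_mult add_eq_0_iff)

lemma lookup_scal_map: "Poly_Mapping.lookup (Poly_Mapping.map (scal c) v) y = scal c (Poly_Mapping.lookup v y)"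
  by (simp add: Poly_Mapping.map.rep_eq when_def)

lemma lookup_module_act: "Poly_Mapping.lookup (module_act a v) y = a * Poly_Mapping.lookup v y"
  by (simp add: module_act_def Poly_Mapping.map.rep_eq when_def)

lemma keys_scal_map: "Poly_Mapping.keys (Poly_Mapping.map (scal c) v) \<subseteq> Poly_Mapping.keys v"
  by (auto simp: in_keys_iff lookup_scal_map)

lemma keys_module_act: "Poly_Mapping.keys (module_act a v) \<subseteq> Poly_Mapping.keys v"
  by (auto simp: in_keys_iff lookup_module_act)

lemma carrier_assoc_mult:
  assumes "a \<in> carrier (assoc_algebra X)" "b \<in> carrier (assoc_algebra X)"
  shows "a * b \<in> carrier (assoc_algebra X)"
  using keys_mult[of a b] assms by (fastforce simp: assoc_algebra_def plus_list_def)

lemma carrier_assoc_add: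
  assumes "a \<in> carrier (assoc_algebra X)" "b \<in> carrier (assoc_algebra X)"
  shows "a + b \<in> carrier (assoc_algebra X)"
  using Poly_Mapping.keys_add[of a b] assms by (fastforce simp: assoc_algebra_def)

lemma carrier_assoc_single0: "Poly_Mapping.single 0 c \<in> carrier (assoc_algebra X)"
  by (simp add: assoc_algebra_def zero_list_def)

lemma carrier_assoc_zero: "0 \<in> carrier (assoc_algebra X)"
  by (simp add: assoc_algebra_def)

lemma carrier_assoc_one: "1 \<in> carrier (assoc_algebra X)"
  using carrier_assoc_single0[of 1] by simp

lemma carrier_assoc_scal:
  "a \<in> carrier (assoc_algebra X) \<Longrightarrow> scal c a \<in> carrier (assoc_algebra X)"
  by (simp add: scal_conv_mult carrier_assoc_mult carrier_assoc_single0)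

lemma carrier_assoc_uminus:
  "a \<in> carrier (assoc_algebra X) \<Longrightarrow> - a \<in> carrier (assoc_algebra X)"
  using carrier_assoc_scal[of a X "- 1"] by (simp add: scal_minus_one)

lemma carrier_assoc_diff:
  "\<lbrakk>a \<in> carrier (assoc_algebra X); b \<in> carrier (assoc_algebra X)\<rbrakk>
    \<Longrightarrow> a - b \<in> carrier (assoc_algebra X)"
  by (metis carrier_assoc_add carrier_assoc_uminus diff_conv_add_uminus)

lemma ring_assoc_algebra: "ring (assoc_algebra X)"
proof (rule ringI)
  show "abelian_group (assoc_algebra X)"
  proof (rule abelian_groupI)
    fix a assume a: "a \<in> carrier (assoc_algebra X)"
    show "\<exists>b\<in>carrier (assoc_algebra X). b \<oplus>\<^bsub>assoc_algebra X\<^esub> a = \<zero>\<^bsub>assoc_algebra X\<^esub>"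
      using carrier_assoc_uminus[OF a] by (intro bexI[of _ "- a"]) (simp_all add: assoc_algebra_def)
  qed (use carrier_assoc_add[of _ X] carrier_assoc_zero[of X] in
        \<open>simp_all add: assoc_algebra_def add.assoc add.commute\<close>)
  show "Group.monoid (assoc_algebra X)"
    by (rule monoidI) (use carrier_assoc_mult[of _ X] carrier_assoc_one[of X] in
      \<open>simp_all add: assoc_algebra_def mult.assoc\<close>)
qed (simp_all add: assoc_algebra_def distrib_left distrib_right)

lemma free_lie_subset: "free_lie_carrier X \<subseteq> carrier (assoc_algebra X)"
proof
  fix a :: "'a assoc"
  assume "a \<in> free_lie_carrier X"
  then show "a \<in> carrier (assoc_algebra X)"
  proof induction
    case (gen i)
    then show ?case by (simp add: gen_def assoc_algebra_def)
  qed (simp_all add: carrier_assoc_zero carrier_assoc_add carrier_assoc_scal carrier_assoc_mult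
        carrier_assoc_diff commutator_def)
qed

lemma linear_space_free_module: "linear_space (free_module X Y)"
proof
  fix v w :: "nat \<Rightarrow>\<^sub>0 'a assoc"
  assume "v \<in> carrier (free_module X Y)" "w \<in> carrier (free_module X Y)"
  then show "ladd (free_module X Y) v w \<in> carrier (free_module X Y)"
    using Poly_Mapping.keys_add[of v w]
    by (auto simp: free_module_def lookup_add carrier_assoc_add)
next
  fix v :: "nat \<Rightarrow>\<^sub>0 'a assoc" and c
  assume "v \<in> carrier (free_module X Y)"
  then show "lscale (free_module X Y) c v \<in> carrier (free_module X Y)"
    using keys_scal_map[of c v]
    by (auto simp: free_module_def lookup_scal_map carrier_assoc_scal)
next
  fix v :: "nat \<Rightarrow>\<^sub>0 'a assoc"
  assume "v \<in> carrier (free_module X Y)"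
  then show "lneg (free_module X Y) v \<in> carrier (free_module X Y)"
    by (auto simp: free_module_def carrier_assoc_uminus in_keys_iff)
qed (auto simp: free_module_def carrier_assoc_zero add.assoc add.commute
      lookup_scal_map lookup_add scal_add add_scal scal_scal scal_one intro!: poly_mapping_eqI)

lemma linear_space_free_lie: "linear_space (free_lie X)"
proof
  fix a :: "'a assoc"
  assume "a \<in> carrier (free_lie X)"
  then show "lneg (free_lie X) a \<in> carrier (free_lie X)"
    using free_lie_carrier.scal[of a X "- 1"] by (simp add: free_lie_def scal_minus_one)
qed (auto simp: free_lie_def add.assoc add.commute scal_add add_scal scal_scal scal_one
      intro: free_lie_carrier.intros)

lemma lie_algebra_free_lie: "lie_algebra (free_lie X)"
proof (rule lie_algebra.intro[OF linear_space_free_lie], unfold_locales)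
qed (auto simp: free_lie_def commutator_def algebra_simps scal_diff mult_scal scal_mult
      intro: free_lie_carrier.commutator[unfolded commutator_def])

lemma lie_rep_free_rep: "lie_rep (free_rep X Y)"
proof (rule lie_rep.intro)
  fix a :: "'a assoc" and v :: "nat \<Rightarrow>\<^sub>0 'a assoc"
  assume "a \<in> carrier (lie (free_rep X Y))" "v \<in> carrier (vec (free_rep X Y))"
  then show "act (free_rep X Y) a v \<in> carrier (vec (free_rep X Y))"
    using keys_module_act[of a v] free_lie_subset[of X]
    by (auto simp: free_rep_def free_lie_def free_module_def lookup_module_act carrier_assoc_mult)
qed (auto simp: free_rep_def free_module_def lie_algebra_free_lie[unfolded free_lie_def]
      linear_space_free_module[unfolded free_module_def] lookup_module_act lookup_scal_map lookup_add
      free_lie_def commutator_def mult_scal scal_mult algebra_simps intro!: poly_mapping_eqI)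

text \<open>The identities defining representations pass to homomorphic images.\<close>

lemma linear_space_image:
  assumes "linear_space V" and f: "f \<in> linear_hom V W" and surj: "carrier W = f ` carrier V"
  shows "linear_space W"
proof -
  interpret linear_space V by fact
  have f0: "lzero W = f (lzero V)"
    and f_neg: "\<And>x. x \<in> carrier V \<Longrightarrow> lneg W (f x) = f (lneg V x)"
    and f_add: "\<And>x y. \<lbrakk>x \<in> carrier V; y \<in> carrier V\<rbrakk> \<Longrightarrow> ladd W (f x) (f y) = f (ladd V x y)"
    and f_scale: "\<And>c x. x \<in> carrier V \<Longrightarrow> lscale W c (f x) = f (lscale V c x)"
    using f by (simp_all add: linear_hom_def)
  note ops = zero_closed neg_closed add_closed scale_closed f0 f_neg f_add f_scale
  show ?thesis
  proof
    fix x y assume "x \<in> carrier W" "y \<in> carrier W"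
    then show "ladd W x y = ladd W y x"
      by (auto simp: surj ops) (metis add_comm)
  qed (auto simp: surj ops add_assoc add_zero add_neg scale_add add_scale scale_scale scale_one)
qed

lemma lie_algebra_image:
  assumes "lie_algebra L" and f: "f \<in> lie_hom L M" and surj: "carrier M = f ` carrier L"
  shows "lie_algebra M"
proof -
  interpret lie_algebra L by fact
  have f0: "lzero M = f (lzero L)"
    and f_add: "\<And>x y. \<lbrakk>x \<in> carrier L; y \<in> carrier L\<rbrakk> \<Longrightarrow> ladd M (f x) (f y) = f (ladd L x y)"
    and f_scale: "\<And>c x. x \<in> carrier L \<Longrightarrow> lscale M c (f x) = f (lscale L c x)"
    and f_br: "\<And>x y. \<lbrakk>x \<in> carrier L; y \<in> carrier L\<rbrakk> \<Longrightarrow> bracket M (f x) (f y) = f (bracket L x y)"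
    using f by (simp_all add: lie_hom_def linear_hom_def)
  have "linear_space M"
    using linear_space_image[OF linear_space_axioms _ surj] f by (simp add: lie_hom_def)
  then show ?thesis
  proof (rule lie_algebra.intro, unfold_locales)
  qed (auto simp: surj add_closed scale_closed bracket_closed f0 f_add f_scale f_br bracket_add_left
      bracket_add_right bracket_scale_left bracket_scale_right bracket_self jacobi)
qed

lemma lie_rep_image:
  assumes "lie_rep F" and fg: "(f, g) \<in> rep_hom F H"
    and surj_l: "carrier (lie H) = f ` carrier (lie F)"
    and surj_v: "carrier (vec H) = g ` carrier (vec F)"
  shows "lie_rep H"
proof -
  interpret lie_rep F by fact
  interpret l: lie_algebra "lie F" by (rule lie)
  interpret v: linear_space "vec F" by (rule vec)
  have l_add: "\<And>x y. \<lbrakk>x \<in> carrier (lie F); y \<in> carrier (lie F)\<rbrakk>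
      \<Longrightarrow> ladd (lie H) (f x) (f y) = f (ladd (lie F) x y)"
    and l_scale: "\<And>c x. x \<in> carrier (lie F) \<Longrightarrow> lscale (lie H) c (f x) = f (lscale (lie F) c x)"
    and l_br: "\<And>x y. \<lbrakk>x \<in> carrier (lie F); y \<in> carrier (lie F)\<rbrakk>
      \<Longrightarrow> bracket (lie H) (f x) (f y) = f (bracket (lie F) x y)"
    and v_neg: "\<And>x. x \<in> carrier (vec F) \<Longrightarrow> lneg (vec H) (g x) = g (lneg (vec F) x)"
    and v_add: "\<And>x y. \<lbrakk>x \<in> carrier (vec F); y \<in> carrier (vec F)\<rbrakk>
      \<Longrightarrow> ladd (vec H) (g x) (g y) = g (ladd (vec F) x y)"
    and v_scale: "\<And>c x. x \<in> carrier (vec F) \<Longrightarrow> lscale (vec H) c (g x) = g (lscale (vec F) c x)"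
    and g_act: "\<And>x y. \<lbrakk>x \<in> carrier (lie F); y \<in> carrier (vec F)\<rbrakk>
      \<Longrightarrow> act H (f x) (g y) = g (act F x y)"
    using fg by (simp_all add: rep_hom_def lie_hom_def linear_hom_def)
  show ?thesis
  proof (rule lie_rep.intro)
    show "lie_algebra (lie H)"
      using lie_algebra_image[OF lie _ surj_l] fg by (simp add: rep_hom_def)
    show "linear_space (vec H)"
      using linear_space_image[OF vec _ surj_v] fg by (simp add: rep_hom_def)
  qed (auto simp: surj_l surj_v l.add_closed l.scale_closed l.bracket_closed v.neg_closed v.add_closed
      v.scale_closed act_closed l_add l_scale l_br v_neg v_add v_scale g_act act_add_left
      act_add_right act_scale_left act_scale_right act_bracket)
qed

lemma linear_quot_hom:
  assumes "linear_space V" and eq: "equiv (carrier V) R"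
    and neg: "\<And>a b. (a, b) \<in> R \<Longrightarrow> (lneg V a, lneg V b) \<in> R"
    and add: "\<And>a b c d. \<lbrakk>(a, b) \<in> R; (c, d) \<in> R\<rbrakk> \<Longrightarrow> (ladd V a c, ladd V b d) \<in> R"
    and scale: "\<And>r a b. (a, b) \<in> R \<Longrightarrow> (lscale V r a, lscale V r b) \<in> R"
  shows "(\<lambda>a. R `` {a}) \<in> linear_hom V (linear_quot V R)"
proof -
  interpret linear_space V by fact
  have c1: "(\<Union>a\<in>R `` {x}. R `` {h a}) = R `` {h x}"
    if "x \<in> carrier V" "\<And>a b. (a, b) \<in> R \<Longrightarrow> (h a, h b) \<in> R" for h x
    using that by (intro UN_equiv_class[OF eq]) (auto intro!: congruentI equiv_class_eq[OF eq])
  have c2: "(\<Union>a\<in>R `` {x}. \<Union>b\<in>R `` {y}. R `` {ladd V a b}) = R `` {ladd V x y}"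
    if "x \<in> carrier V" "y \<in> carrier V" for x y
    using that
    by (intro UN_equiv_class2[OF eq eq]) (auto intro!: congruent2I' equiv_class_eq[OF eq] add)
  show ?thesis
    by (auto simp: linear_hom_def linear_quot_def zero_closed quotientI c1 c2 neg scale)
qed

lemma rep_quot_lie_rep:
  assumes "lie_rep F"
    and eql: "equiv (carrier (lie F)) (Inl -` T)" and eqv: "equiv (carrier (vec F)) (Inr -` T)"
    and l_neg: "\<And>a b. Inl (a, b) \<in> T \<Longrightarrow> Inl (lneg (lie F) a, lneg (lie F) b) \<in> T"
    and l_add: "\<And>a b c d. \<lbrakk>Inl (a, b) \<in> T; Inl (c, d) \<in> T\<rbrakk>
      \<Longrightarrow> Inl (ladd (lie F) a c, ladd (lie F) b d) \<in> T"
    and l_scale: "\<And>r a b. Inl (a, b) \<in> T \<Longrightarrow> Inl (lscale (lie F) r a, lscale (lie F) r b) \<in> T"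
    and l_br: "\<And>a b c d. \<lbrakk>Inl (a, b) \<in> T; Inl (c, d) \<in> T\<rbrakk>
      \<Longrightarrow> Inl (bracket (lie F) a c, bracket (lie F) b d) \<in> T"
    and v_neg: "\<And>a b. Inr (a, b) \<in> T \<Longrightarrow> Inr (lneg (vec F) a, lneg (vec F) b) \<in> T"
    and v_add: "\<And>a b c d. \<lbrakk>Inr (a, b) \<in> T; Inr (c, d) \<in> T\<rbrakk>
      \<Longrightarrow> Inr (ladd (vec F) a c, ladd (vec F) b d) \<in> T"
    and v_scale: "\<And>r a b. Inr (a, b) \<in> T \<Longrightarrow> Inr (lscale (vec F) r a, lscale (vec F) r b) \<in> T"
    and act: "\<And>a b v w. \<lbrakk>Inl (a, b) \<in> T; Inr (v, w) \<in> T\<rbrakk> \<Longrightarrow> Inr (act F a v, act F b w) \<in> T"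
  shows "(\<lambda>a. (Inl -` T) `` {a}, \<lambda>v. (Inr -` T) `` {v}) \<in> rep_hom F (rep_quot F T)"
    and "lie_rep (rep_quot F T)"
proof -
  interpret lie_rep F by fact
  interpret l: lie_algebra "lie F" by (rule lie)
  interpret v: linear_space "vec F" by (rule vec)
  let ?L = "Inl -` T" and ?V = "Inr -` T"
  have br: "(\<Union>a\<in>?L `` {x}. \<Union>b\<in>?L `` {y}. ?L `` {bracket (lie F) a b}) = ?L `` {bracket (lie F) x y}"
    if "x \<in> carrier (lie F)" "y \<in> carrier (lie F)" for x y
    using that
    by (intro UN_equiv_class2[OF eql eql]) (auto intro!: congruent2I' equiv_class_eq[OF eql] l_br)
  have ac: "(\<Union>a\<in>?L `` {x}. \<Union>b\<in>?V `` {y}. ?V `` {act F a b}) = ?V `` {act F x y}"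
    if "x \<in> carrier (lie F)" "y \<in> carrier (vec F)" for x y
    using that
    by (intro UN_equiv_class2[OF eql eqv]) (auto intro!: congruent2I' equiv_class_eq[OF eqv] act)
  have "(\<lambda>a. ?L `` {a}) \<in> linear_hom (lie F) (linear_quot (lie F) ?L)"
    by (rule linear_quot_hom[OF l.linear_space_axioms eql]) (simp_all add: l_neg l_add l_scale)
  then have "(\<lambda>a. ?L `` {a}) \<in> lie_hom (lie F) (lie_quot (lie F) ?L)"
    by (simp add: lie_hom_def lie_quot_def linear_hom_def linear_quot_def
        linear_space.defs lie_algebra.defs br)
  moreover have "(\<lambda>a. ?V `` {a}) \<in> linear_hom (vec F) (linear_quot (vec F) ?V)"
    by (rule linear_quot_hom[OF vec eqv]) (simp_all add: v_neg v_add v_scale)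
  ultimately show hom: "(\<lambda>a. ?L `` {a}, \<lambda>v. ?V `` {v}) \<in> rep_hom F (rep_quot F T)"
    by (simp add: rep_hom_def rep_quot_def ac)
  show "lie_rep (rep_quot F T)"
    by (rule lie_rep_image[OF assms(1) hom])
      (auto simp: rep_quot_def lie_quot_def linear_quot_def quotient_def
        linear_space.defs lie_algebra.defs)
qed

lemma lie_rep_twist:
  assumes "field_automorphism \<phi>" "lie_rep H"
  shows "lie_rep (twist \<phi> H)"
proof -
  interpret lie_rep H by fact
  interpret l: lie_algebra "lie H" by (rule lie)
  interpret v: linear_space "vec H" by (rule vec)
  note \<phi> = assms(1)[unfolded field_automorphism_def]
  have "linear_space (lie (twist \<phi> H))" "linear_space (vec (twist \<phi> H))"
    by (unfold_locales; simp add: twist_def \<phi> l.zero_closed l.neg_closed l.add_closed l.scale_closed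
        l.add_assoc l.add_zero l.add_neg l.scale_add l.add_scale l.scale_scale l.scale_one
        v.zero_closed v.neg_closed v.add_closed v.scale_closed
        v.add_assoc v.add_zero v.add_neg v.scale_add v.add_scale v.scale_scale v.scale_one;
        (metis l.add_comm v.add_comm)?)+
  moreover from this have "lie_algebra (lie (twist \<phi> H))"
    by (intro lie_algebra.intro lie_algebra_axioms.intro)
      (auto simp: twist_def l.bracket_closed l.bracket_add_left l.bracket_add_right
        l.bracket_scale_left l.bracket_scale_right l.bracket_self l.jacobi)
  ultimately show ?thesis
    by (intro lie_rep.intro) (auto simp: twist_def act_closed act_add_left act_add_right
        act_scale_left act_scale_right act_bracket)
qed

context
  notes One_nat_def [simp del]
begin

lemma gen_carrier: "i \<in> X \<Longrightarrow> gen i \<in> carrier (assoc_algebra X)"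
  by (simp add: gen_def assoc_algebra_def)

lemma t_elem_carrier: "t_elem lam \<in> carrier assoc_A"
  by (simp add: t_elem_def e2_def e4_def commutator_def carrier_assoc_add carrier_assoc_diff
      carrier_assoc_mult carrier_assoc_scal gen_carrier)

lemma ideal_N: "ideal ideal_N assoc_A"
  unfolding ideal_N_def by (rule ring.genideal_ideal[OF ring_assoc_algebra]) (simp add: gen_carrier)

lemma ideal_N_pow: "ideal (ideal_N [^]\<^bsub>ideals_set assoc_A\<^esub> (n::nat)) assoc_A"
proof (induction n)
  case 0
  then show ?case by (simp add: ideals_set_def nat_pow_def ring.oneideal[OF ring_assoc_algebra])
next
  case (Suc n)
  then show ?case
    using ring.ideal_prod_is_ideal[OF ring_assoc_algebra Suc ideal_N]
    by (simp add: ideals_set_def nat_pow_def)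
qed

lemma ideal_ideal_I: "ideal (ideal_I lam) assoc_A"
  unfolding ideal_I_def
  by (rule ring.genideal_ideal[OF ring_assoc_algebra])
    (use additive_subgroup.a_subset[OF ideal.axioms(1)[OF ideal_N_pow]] t_elem_carrier in auto)

lemma module_act_x_vec: "module_act a x_vec = Poly_Mapping.single 1 a"
  by (simp add: module_act_def x_vec_def)

lemma Q_sub_iff:
  assumes "Poly_Mapping.keys v \<subseteq> {1}"
  shows "v \<in> snd (Q_sub lam) \<longleftrightarrow> Poly_Mapping.lookup v 1 \<in> ideal_I lam"
proof
  assume "v \<in> snd (Q_sub lam)"
  then show "Poly_Mapping.lookup v 1 \<in> ideal_I lam"
    by (auto simp: Q_sub_def module_act_x_vec)
next
  assume *: "Poly_Mapping.lookup v 1 \<in> ideal_I lam"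
  have "v = Poly_Mapping.single 1 (Poly_Mapping.lookup v 1)"
    using assms by (intro poly_mapping_eqI[where f = v]) (auto simp: lookup_single when_def in_keys_iff)
  with * show "v \<in> snd (Q_sub lam)"
    unfolding Q_sub_def by (auto simp: module_act_x_vec)
qed

lemma ideal_I_closed:
  shows ideal_I_add: "\<lbrakk>a \<in> ideal_I lam; b \<in> ideal_I lam\<rbrakk> \<Longrightarrow> a + b \<in> ideal_I lam"
    and ideal_I_mult: "\<lbrakk>a \<in> carrier assoc_A; b \<in> ideal_I lam\<rbrakk> \<Longrightarrow> a * b \<in> ideal_I lam"
    and ideal_I_mult2: "\<lbrakk>a \<in> ideal_I lam; b \<in> carrier assoc_A\<rbrakk> \<Longrightarrow> a * b \<in> ideal_I lam"
    and ideal_I_scal: "a \<in> ideal_I lam \<Longrightarrow> scal c a \<in> ideal_I lam"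
    and ideal_I_zero: "0 \<in> ideal_I lam"
    and ideal_I_uminus: "a \<in> ideal_I lam \<Longrightarrow> - a \<in> ideal_I lam"
proof -
  interpret I: ideal "ideal_I lam" assoc_A by (rule ideal_ideal_I)
  show mult: "a * b \<in> ideal_I lam" if "a \<in> carrier assoc_A" "b \<in> ideal_I lam" for a b
    using I.I_l_closed[OF that(2,1)] by (simp add: assoc_algebra_def)
  show "a * b \<in> ideal_I lam" if "a \<in> ideal_I lam" "b \<in> carrier assoc_A" for a b
    using I.I_r_closed[OF that] by (simp add: assoc_algebra_def)
  show "a + b \<in> ideal_I lam" if "a \<in> ideal_I lam" "b \<in> ideal_I lam" for a b
    using additive_subgroup.a_closed[OF I.is_additive_subgroup that] by (simp add: assoc_algebra_def)
  show scal: "scal c a \<in> ideal_I lam" if "a \<in> ideal_I lam" for a c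
    using mult[OF carrier_assoc_single0 that] by (simp add: scal_conv_mult)
  show "0 \<in> ideal_I lam"
    using additive_subgroup.zero_closed[OF I.is_additive_subgroup] by (simp add: assoc_algebra_def)
  show "- a \<in> ideal_I lam" if "a \<in> ideal_I lam" for a
    using scal[OF that, of "- 1"] by (simp add: scal_minus_one)
qed

lemma congruence_F_lie:
  "Inl (a, b) \<in> congruence_of F_rep (Q_sub lam) \<longleftrightarrow> a \<in> free_lie_carrier {1, 2} \<and> a = b"
  by (auto simp: congruence_of_def F_rep_def free_rep_def free_lie_def Q_sub_def)

lemma congruence_F_vec:
  "Inr (u, v) \<in> congruence_of F_rep (Q_sub lam) \<longleftrightarrow>
     u \<in> carrier (free_module {1, 2} {1}) \<and> v \<in> carrier (free_module {1, 2} {1}) \<and>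
     Poly_Mapping.lookup u 1 - Poly_Mapping.lookup v 1 \<in> ideal_I lam"
proof -
  have "u - v \<in> snd (Q_sub lam) \<longleftrightarrow> Poly_Mapping.lookup u 1 - Poly_Mapping.lookup v 1 \<in> ideal_I lam"
    if "u \<in> carrier (free_module {1, 2} {1})" "v \<in> carrier (free_module {1, 2} {1})"
  proof -
    have "Poly_Mapping.keys (u - v) \<subseteq> {1}"
      using that keys_diff[of u v] by (auto simp: free_module_def)
    from Q_sub_iff[OF this] show ?thesis by (simp add: lookup_minus)
  qed
  then show ?thesis
    by (auto simp: congruence_of_def F_rep_def free_rep_def free_module_def)
qed

lemma lie_rep_F_rep: "lie_rep F_rep"
  by (simp add: F_rep_def lie_rep_free_rep)

lemma lie_rep_H_rep: "lie_rep (H_rep lam)"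
  unfolding H_rep_def
proof (rule rep_quot_lie_rep(2)[OF lie_rep_F_rep])
  let ?T = "congruence_of F_rep (Q_sub lam)"
  interpret l: lie_algebra "lie F_rep :: ('a, 'a assoc) lie_algebra"
    by (rule lie_rep.lie[OF lie_rep_F_rep])
  interpret v: linear_space "vec F_rep :: ('a, nat \<Rightarrow>\<^sub>0 'a assoc) linear_space"
    by (rule lie_rep.vec[OF lie_rep_F_rep])
  have l: "carrier (lie F_rep) = free_lie_carrier {1, 2}"
    by (simp add: F_rep_def free_rep_def free_lie_def)
  have v: "carrier (vec F_rep) = carrier (free_module {1, 2} {1})"
    by (simp add: F_rep_def free_rep_def)
  have ops: "ladd (vec F_rep) = (+)" "lneg (vec F_rep) = uminus"
    "lscale (vec F_rep) = (\<lambda>c. Poly_Mapping.map (scal c))" "act F_rep = module_act"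
    by (simp_all add: F_rep_def free_rep_def free_module_def)
  show "equiv (carrier (lie F_rep)) (Inl -` ?T)"
    by (auto simp: equiv_def refl_on_def sym_on_def trans_on_def congruence_F_lie l)
  show "equiv (carrier (vec F_rep)) (Inr -` ?T)"
  proof (rule equivI)
    show "sym (Inr -` ?T)"
      using ideal_I_uminus[of "_ - _" lam] by (fastforce simp: sym_on_def congruence_F_vec)
    show "trans (Inr -` ?T)"
    proof (rule transI)
      fix x y z assume "(x, y) \<in> Inr -` ?T" "(y, z) \<in> Inr -` ?T"
      then show "(x, z) \<in> Inr -` ?T"
        using ideal_I_add[of "Poly_Mapping.lookup x 1 - Poly_Mapping.lookup y 1" lam
            "Poly_Mapping.lookup y 1 - Poly_Mapping.lookup z 1"]
        by (simp add: congruence_F_vec)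
    qed
  qed (auto simp: refl_on_def congruence_F_vec v ideal_I_zero)
  show "Inl (lneg (lie F_rep) a, lneg (lie F_rep) b) \<in> ?T" if "Inl (a, b) \<in> ?T" for a b
    using that l.neg_closed by (auto simp: congruence_F_lie simp flip: l)
  show "Inl (lscale (lie F_rep) r a, lscale (lie F_rep) r b) \<in> ?T" if "Inl (a, b) \<in> ?T" for r a b
    using that l.scale_closed by (auto simp: congruence_F_lie simp flip: l)
  show "Inl (ladd (lie F_rep) a c, ladd (lie F_rep) b d) \<in> ?T"
    and "Inl (bracket (lie F_rep) a c, bracket (lie F_rep) b d) \<in> ?T"
    if "Inl (a, b) \<in> ?T" "Inl (c, d) \<in> ?T" for a b c d
    using that l.add_closed l.bracket_closed by (auto simp: congruence_F_lie simp flip: l)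
  show "Inr (lneg (vec F_rep) a, lneg (vec F_rep) b) \<in> ?T" if "Inr (a, b) \<in> ?T" for a b
    using that v.neg_closed ideal_I_uminus[of "Poly_Mapping.lookup a 1 - Poly_Mapping.lookup b 1" lam]
    by (simp add: congruence_F_vec ops flip: v)
  show "Inr (lscale (vec F_rep) r a, lscale (vec F_rep) r b) \<in> ?T" if "Inr (a, b) \<in> ?T" for r a b
    using that v.scale_closed[of _ r]
      ideal_I_scal[of "Poly_Mapping.lookup a 1 - Poly_Mapping.lookup b 1" lam r]
    by (simp add: congruence_F_vec ops lookup_scal_map scal_diff flip: v)
  show "Inr (ladd (vec F_rep) a c, ladd (vec F_rep) b d) \<in> ?T"
    if "Inr (a, b) \<in> ?T" "Inr (c, d) \<in> ?T" for a b c d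
    using that v.add_closed ideal_I_add[of "Poly_Mapping.lookup a 1 - Poly_Mapping.lookup b 1" lam
        "Poly_Mapping.lookup c 1 - Poly_Mapping.lookup d 1"]
    by (simp add: congruence_F_vec ops lookup_add algebra_simps flip: v)
  show "Inr (act F_rep a v, act F_rep b w) \<in> ?T"
    if "Inl (a, b) \<in> ?T" "Inr (v, w) \<in> ?T" for a b v w
    using that lie_rep.act_closed[OF lie_rep_F_rep] free_lie_subset[of "{1, 2}"]
      ideal_I_mult[of a "Poly_Mapping.lookup v 1 - Poly_Mapping.lookup w 1" lam]
    by (auto simp add: congruence_F_vec congruence_F_lie ops lookup_module_act
        right_diff_distrib simp flip: v l)
qed

lemma lie_rep_twist_H_rep: "field_automorphism \<phi> \<Longrightarrow> lie_rep (twist \<phi> (H_rep lam))"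
  by (simp add: lie_rep_twist lie_rep_H_rep)

end

end

theory Submission
  imports Defs
begin

text \<open>The single pair \<open>(t \<circ> x, 0)\<close> separates the two representations.
  The projection \<open>F \<rightarrow> H\<close> kills \<open>t \<circ> x\<close> but not \<open>e\<^sub>2 \<circ> x\<close>. A homomorphism from \<open>F\<close> to the twisted
  representation sends \<open>x\<^sub>1, x\<^sub>2, x\<close> to classes of Lie elements \<open>a, b\<close> and of \<open>p \<circ> x\<close>, and if it kills
  \<open>t \<circ> x\<close> then \<open>(\<phi>(\<lambda>) e\<^sub>2(a, b) + e\<^sub>4(a, b)) p \<in> I\<close>. Modulo words of length at least \<open>6\<close>, this says that
  the value of \<open>\<phi>(\<lambda>) e\<^sub>2 + e\<^sub>4\<close> at the linear parts of \<open>a, b\<close>, times the constant term of \<open>p\<close>, is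
  a multiple of \<open>t\<close>. If the constant term vanishes or the linear parts are dependent, then
  \<open>e\<^sub>2(a, b) p\<close> has order at least \<open>6\<close>, so \<open>e\<^sub>2 \<circ> x\<close> is killed as well. Otherwise
  the linear parts must be multiples of \<open>x\<^sub>1\<close> and \<open>x\<^sub>2\<close>, and comparing coefficients
  gives \<open>\<phi>(\<lambda>) = \<lambda>\<close>.\<close>

section \<open>Order of noncommutative polynomials\<close>

lemma poly_mapping_sum_single_superset:
  assumes "finite S" "Poly_Mapping.keys p \<subseteq> S"
  shows "p = (\<Sum>k\<in>S. Poly_Mapping.single k (Poly_Mapping.lookup p k))"
  using assms by (subst poly_mapping_sum_single) (auto intro!: sum.mono_neutral_left simp: in_keys_iff)

text \<open>The pairs \<open>(u, v)\<close> with \<open>u @ v = w\<close> are exactly the cuts of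
  \<open>w\<close>, so the convolution becomes a sum over cut positions.\<close>

lemma lookup_mult_words:
  fixes p q :: "'k::field assoc"
  shows "Poly_Mapping.lookup (p * q) w =
    (\<Sum>i\<le>length w. Poly_Mapping.lookup p (take i w) * Poly_Mapping.lookup q (drop i w))"
proof -
  \<comment> \<open>The supports are enlarged by the prefixes and suffixes of \<open>w\<close>, so
    that every cut is a pair in \<open>S \<times> S'\<close>; the added coefficients are
    zero.\<close>
  define S where "S = Poly_Mapping.keys p \<union> (\<lambda>i. take i w) ` {..length w}"
  define S' where "S' = Poly_Mapping.keys q \<union> (\<lambda>i. drop i w) ` {..length w}"
  have fin: "finite S" "finite S'" by (simp_all add: S_def S'_def)
  let ?f = "\<lambda>(u, v). Poly_Mapping.lookup p u * Poly_Mapping.lookup q v"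
  have "p * q = (\<Sum>u\<in>S. Poly_Mapping.single u (Poly_Mapping.lookup p u)) *
      (\<Sum>v\<in>S'. Poly_Mapping.single v (Poly_Mapping.lookup q v))"
    using poly_mapping_sum_single_superset[OF fin(1), of p]
      poly_mapping_sum_single_superset[OF fin(2), of q] by (simp add: S_def S'_def)
  also have "\<dots> = (\<Sum>(u, v)\<in>S \<times> S'. Poly_Mapping.single (u @ v) (?f (u, v)))"
    by (simp add: sum_product sum.cartesian_product mult_single plus_list_def)
  finally have "Poly_Mapping.lookup (p * q) w = (\<Sum>(u, v)\<in>S \<times> S'. ?f (u, v) when u @ v = w)"
    by (simp add: lookup_sum lookup_single split_def)
  also have "\<dots> = sum ?f ((\<lambda>i. (take i w, drop i w)) ` {..length w})"
  proof (rule sum.mono_neutral_cong_right)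
    show "(\<lambda>i. (take i w, drop i w)) ` {..length w} \<subseteq> S \<times> S'"
      by (auto simp: S_def S'_def)
    show "\<forall>x\<in>S \<times> S' - (\<lambda>i. (take i w, drop i w)) ` {..length w}.
        (case x of (u, v) \<Rightarrow> ?f (u, v) when u @ v = w) = 0"
    proof
      fix x assume *: "x \<in> S \<times> S' - (\<lambda>i. (take i w, drop i w)) ` {..length w}"
      obtain u v where x: "x = (u, v)" by (cases x)
      have "u @ v \<noteq> w"
      proof
        assume "u @ v = w"
        then have "(u, v) = (take (length u) w, drop (length u) w)" "length u \<le> length w" by auto
        with * x show False by blast
      qed
      then show "(case x of (u, v) \<Rightarrow> ?f (u, v) when u @ v = w) = 0" by (simp add: x)
    qed
  qed (use fin in \<open>auto simp: when_def\<close>)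
  also have "\<dots> = (\<Sum>i\<le>length w. ?f (take i w, drop i w))"
    by (subst sum.reindex)
      (auto intro!: inj_onI dest!: arg_cong[where f = length] simp: min_def split: if_splits)
  finally show ?thesis by simp
qed

text \<open>On \<open>assoc_A\<close> this is membership in the power \<open>N^n\<close>
  (\<open>ideal_N_pow_order\<close>, \<open>order_ge_ideal_N_pow\<close>), expressed by coefficients
  so that products can be computed.\<close>

definition order_ge :: "nat \<Rightarrow> 'k::field assoc \<Rightarrow> bool" where
  "order_ge n p \<longleftrightarrow> (\<forall>w. length w < n \<longrightarrow> Poly_Mapping.lookup p w = 0)"

lemma order_ge_0 [simp]: "order_ge 0 p"
  by (simp add: order_ge_def)

lemma order_ge_zero [simp]: "order_ge n 0"
  by (simp add: order_ge_def)

lemma order_ge_add: "\<lbrakk>order_ge n p; order_ge n q\<rbrakk> \<Longrightarrow> order_ge n (p + q)"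
  by (simp add: order_ge_def lookup_add)

lemma order_ge_diff: "\<lbrakk>order_ge n p; order_ge n q\<rbrakk> \<Longrightarrow> order_ge n (p - q)"
  by (simp add: order_ge_def lookup_minus)

lemma lookup_scal: "Poly_Mapping.lookup (scal c p) w = c * Poly_Mapping.lookup p w"
  by (simp add: scal_def Poly_Mapping.map.rep_eq when_def)

lemma order_ge_scal: "order_ge n p \<Longrightarrow> order_ge n (scal c p)"
  by (simp add: order_ge_def lookup_scal)

lemma order_ge_mono: "\<lbrakk>order_ge n p; m \<le> n\<rbrakk> \<Longrightarrow> order_ge m p"
  by (auto simp: order_ge_def)

lemma order_ge_Suc:
  "order_ge (Suc n) p \<longleftrightarrow> order_ge n p \<and> (\<forall>w. length w = n \<longrightarrow> Poly_Mapping.lookup p w = 0)"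
  by (auto simp: order_ge_def less_Suc_eq)

text \<open>Only the cut at \<open>m\<close> survives: an earlier one leaves too short a prefix for
  \<open>p\<close>, a later one too short a suffix for \<open>q\<close>. With \<open>m = 0\<close>
  the factor \<open>p\<close> enters only through its constant term, and likewise \<open>q\<close>
  with \<open>n = 0\<close>.\<close>

lemma lookup_mult_order:
  assumes "order_ge m p" "order_ge n q" "length w = m + n"
  shows "Poly_Mapping.lookup (p * q) w =
    Poly_Mapping.lookup p (take m w) * Poly_Mapping.lookup q (drop m w)"
proof -
  have "(\<Sum>i\<le>length w. Poly_Mapping.lookup p (take i w) * Poly_Mapping.lookup q (drop i w))
      = (\<Sum>i\<in>{m}. Poly_Mapping.lookup p (take i w) * Poly_Mapping.lookup q (drop i w))"
  proof (rule sum.mono_neutral_right)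
    show "\<forall>i\<in>{..length w} - {m}. Poly_Mapping.lookup p (take i w) * Poly_Mapping.lookup q (drop i w) = 0"
    proof
      fix i assume "i \<in> {..length w} - {m}"
      then consider "i < m" | "length w - i < n" "i \<le> length w" using assms(3) by fastforce
      then show "Poly_Mapping.lookup p (take i w) * Poly_Mapping.lookup q (drop i w) = 0"
        using assms(1,2) by cases (auto simp: order_ge_def min_def)
    qed
  qed (use assms(3) in auto)
  then show ?thesis by (simp add: lookup_mult_words)
qed

lemma order_ge_mult:
  assumes "order_ge m p" "order_ge n q"
  shows "order_ge (m + n) (p * q)"
  unfolding order_ge_def
proof (intro allI impI)
  fix w :: "nat list" assume w: "length w < m + n"
  have "Poly_Mapping.lookup p (take i w) * Poly_Mapping.lookup q (drop i w) = 0" if "i \<le> length w" for i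
  proof (cases "i < m")
    case True
    then show ?thesis using assms(1) by (simp add: order_ge_def)
  next
    case False
    then have "length w - i < n" using w that by linarith
    then show ?thesis using assms(2) by (simp add: order_ge_def)
  qed
  then show "Poly_Mapping.lookup (p * q) w = 0"
    unfolding lookup_mult_words by (intro sum.neutral) simp
qed

lemma order_ge_commutator:
  "\<lbrakk>order_ge m p; order_ge n q\<rbrakk> \<Longrightarrow> order_ge (m + n) (commutator p q)"
  using order_ge_mult[of m p n q] order_ge_mult[of n q m p]
  by (simp add: commutator_def order_ge_diff add.commute)

lemma lookup_commutator_order:
  assumes "order_ge m p" "order_ge n q" "length w = m + n"
  shows "Poly_Mapping.lookup (commutator p q) w =
    Poly_Mapping.lookup p (take m w) * Poly_Mapping.lookup q (drop m w) -
    Poly_Mapping.lookup q (take n w) * Poly_Mapping.lookup p (drop n w)"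
  using lookup_mult_order[OF assms] lookup_mult_order[OF assms(2,1)] assms(3)
  by (simp add: commutator_def lookup_minus)

text \<open>The generators are letters, and a commutator of two elements without constant term even
  starts in degree two. Hence a Lie word of degree five evaluated at Lie elements has order at least
  5.\<close>

lemma order_ge_free_lie: "a \<in> free_lie_carrier X \<Longrightarrow> order_ge 1 a"
proof (induction rule: free_lie_carrier.induct)
  case (gen i)
  then show ?case by (simp add: order_ge_def gen_def lookup_single)
next
  case (commutator a b)
  then show ?case using order_ge_commutator[of 1 a 1 b] by (auto intro: order_ge_mono)
qed (simp_all add: order_ge_add order_ge_scal)


section \<open>The two Lie words of degree five\<close>

text \<open>\<open>e2\<close> and \<open>e4\<close> become words in two arguments, because a
  homomorphism evaluates them at arbitrary Lie elements in place of \<open>x1\<close>,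
  \<open>x2\<close>.\<close>

definition lie2 :: "'k::field assoc \<Rightarrow> 'k assoc \<Rightarrow> 'k assoc" where
  "lie2 a b = commutator a (commutator a (commutator (commutator a b) b))"

definition lie4 :: "'k::field assoc \<Rightarrow> 'k assoc \<Rightarrow> 'k assoc" where
  "lie4 a b = commutator (commutator a (commutator a b)) (commutator a b)"

text \<open>\<open>c2\<close>, \<open>c3\<close>, \<open>d3\<close>, \<open>c4\<close> are the lowest-degree coefficients of
  \<open>[a, b]\<close>, \<open>[[a, b], b]\<close>, \<open>[a, [a, b]]\<close>, \<open>[a, [[a, b], b]]\<close> for \<open>a\<close>, \<open>b\<close> of order at least \<open>1\<close>.\<close>

definition "c2 a b i j = Poly_Mapping.lookup a [i] * Poly_Mapping.lookup b [j] -
  Poly_Mapping.lookup b [i] * Poly_Mapping.lookup a [j]" for a b :: "'k::field assoc"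

definition "c3 a b i j k = c2 a b i j * Poly_Mapping.lookup b [k] - Poly_Mapping.lookup b [i] * c2 a b j k"
  for a b :: "'k::field assoc"

definition "d3 a b i j k = Poly_Mapping.lookup a [i] * c2 a b j k - c2 a b i j * Poly_Mapping.lookup a [k]"
  for a b :: "'k::field assoc"

definition "c4 a b i j k l = Poly_Mapping.lookup a [i] * c3 a b j k l - c3 a b i j k * Poly_Mapping.lookup a [l]"
  for a b :: "'k::field assoc"

context
  fixes a b :: "'k::field assoc"
  assumes ord_a: "order_ge 1 a" and ord_b: "order_ge 1 b"
begin

lemma ord_c2: "order_ge 2 (commutator a b)"
  using order_ge_commutator[OF ord_a ord_b] by (simp add: numeral_eq_Suc)

lemma ord_c3: "order_ge 3 (commutator (commutator a b) b)"
  using order_ge_commutator[OF ord_c2 ord_b] by (simp add: numeral_eq_Suc)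

lemma ord_d3: "order_ge 3 (commutator a (commutator a b))"
  using order_ge_commutator[OF ord_a ord_c2] by (simp add: numeral_eq_Suc)

lemma ord_c4: "order_ge 4 (commutator a (commutator (commutator a b) b))"
  using order_ge_commutator[OF ord_a ord_c3] by (simp add: numeral_eq_Suc)

lemma order_ge_lie2: "order_ge 5 (lie2 a b)"
  using order_ge_commutator[OF ord_a ord_c4] by (simp add: numeral_eq_Suc lie2_def)

lemma order_ge_lie4: "order_ge 5 (lie4 a b)"
  using order_ge_commutator[OF ord_d3 ord_c2] by (simp add: numeral_eq_Suc lie4_def)

lemma lookup_c2: "Poly_Mapping.lookup (commutator a b) [i, j] = c2 a b i j"
  using lookup_commutator_order[OF ord_a ord_b, of "[i, j]"] by (simp add: c2_def)

lemma lookup_c3: "Poly_Mapping.lookup (commutator (commutator a b) b) [i, j, k] = c3 a b i j k"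
  using lookup_commutator_order[OF ord_c2 ord_b, of "[i, j, k]"] by (simp add: c3_def lookup_c2)

lemma lookup_d3: "Poly_Mapping.lookup (commutator a (commutator a b)) [i, j, k] = d3 a b i j k"
  using lookup_commutator_order[OF ord_a ord_c2, of "[i, j, k]"] by (simp add: d3_def lookup_c2)

lemma lookup_c4:
  "Poly_Mapping.lookup (commutator a (commutator (commutator a b) b)) [i, j, k, l] = c4 a b i j k l"
  using lookup_commutator_order[OF ord_a ord_c3, of "[i, j, k, l]"] by (simp add: c4_def lookup_c3)

lemma lookup_lie2:
  "Poly_Mapping.lookup (lie2 a b) [i, j, k, l, m] = Poly_Mapping.lookup a [i] * c4 a b j k l m - c4 a b i j k l * Poly_Mapping.lookup a [m]"
  using lookup_commutator_order[OF ord_a ord_c4, of "[i, j, k, l, m]"]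
  by (simp add: lie2_def lookup_c4)

lemma lookup_lie4:
  "Poly_Mapping.lookup (lie4 a b) [i, j, k, l, m] = d3 a b i j k * c2 a b l m - c2 a b i j * d3 a b k l m"
  using lookup_commutator_order[OF ord_d3 ord_c2, of "[i, j, k, l, m]"]
  by (simp add: lie4_def lookup_c2 lookup_d3)

end

lemmas lookup_lie = lookup_lie2 lookup_lie4 c2_def c3_def c4_def d3_def


section \<open>The ideal \<open>I\<close>\<close>

context
  notes One_nat_def [simp del]
begin

lemma t_elem_lie: "t_elem lam = scal lam (lie2 x1 x2) + lie4 x1 x2"
  by (simp add: t_elem_def e2_def e4_def lie2_def lie4_def)

lemma order_ge_gen: "order_ge 1 (gen i)"
  by (rule order_ge_free_lie[of _ UNIV]) (simp add: free_lie_carrier.gen)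

lemma lookup_gen: "Poly_Mapping.lookup (gen i) [j] = (if i = j then 1 else 0)"
  by (simp add: gen_def lookup_single when_def)

lemma order_ge_t_elem: "order_ge 5 (t_elem lam)"
  by (simp add: t_elem_lie order_ge_add order_ge_scal order_ge_lie2 order_ge_lie4 order_ge_gen)

section \<open>Powers of \<open>N\<close> and the degree-five part of \<open>I\<close>\<close>

lemma ideal_assocI:
  assumes "J \<subseteq> carrier (assoc_algebra X)" "0 \<in> J" "\<And>p q. \<lbrakk>p \<in> J; q \<in> J\<rbrakk> \<Longrightarrow> p + q \<in> J"
    and l: "\<And>a p. \<lbrakk>a \<in> carrier (assoc_algebra X); p \<in> J\<rbrakk> \<Longrightarrow> a * p \<in> J"
    and r: "\<And>a p. \<lbrakk>a \<in> carrier (assoc_algebra X); p \<in> J\<rbrakk> \<Longrightarrow> p * a \<in> J"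
  shows "ideal J (assoc_algebra X)"
proof -
  interpret R: ring "assoc_algebra X" by (rule ring_assoc_algebra)
  \<comment> \<open>Negation is left multiplication by the constant \<open>- 1\<close>.\<close>
  have neg: "- p \<in> J" if "p \<in> J" for p
    using l[OF carrier_assoc_single0[of "- 1"] that] scal_minus_one[of p]
    by (simp add: scal_conv_mult)
  show ?thesis
  proof (rule idealI)
    show "subgroup J (add_monoid (assoc_algebra X))"
    proof (rule R.add.subgroupI)
      fix p assume p: "p \<in> J"
      then have "\<ominus>\<^bsub>assoc_algebra X\<^esub> p = - p"
        using assms(1) neg[OF p] by (intro R.minus_equality) (auto simp: assoc_algebra_def)
      then show "\<ominus>\<^bsub>assoc_algebra X\<^esub> p \<in> J"
        using neg[OF p] by simp
    qed (use assms in \<open>auto simp: assoc_algebra_def\<close>)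
  qed (use assms ring_assoc_algebra in \<open>auto simp: assoc_algebra_def\<close>)
qed

lemma ideal_order_ge: "ideal {p \<in> carrier (assoc_algebra X). order_ge n p} (assoc_algebra X)"
proof (rule ideal_assocI)
  fix a p :: "'a assoc"
  assume "a \<in> carrier (assoc_algebra X)" "p \<in> {p \<in> carrier (assoc_algebra X). order_ge n p}"
  then show "a * p \<in> {p \<in> carrier (assoc_algebra X). order_ge n p}"
    and "p * a \<in> {p \<in> carrier (assoc_algebra X). order_ge n p}"
    using order_ge_mult[of 0 a n p] order_ge_mult[of n p 0 a] by (simp_all add: carrier_assoc_mult)
qed (auto simp: carrier_assoc_zero carrier_assoc_add order_ge_add)

lemma ideal_N_order: "ideal_N \<subseteq> {p \<in> carrier assoc_A. order_ge 1 p}"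
  unfolding ideal_N_def
  by (rule ring.genideal_minimal[OF ring_assoc_algebra ideal_order_ge])
    (simp add: gen_carrier order_ge_gen)

lemma ideal_N_pow_Suc:
  "ideal_N [^]\<^bsub>ideals_set assoc_A\<^esub> Suc n =
    ideal_prod assoc_A (ideal_N [^]\<^bsub>ideals_set assoc_A\<^esub> n) ideal_N"
  by (simp add: nat_pow_def ideals_set_def)

lemma ideal_N_pow_order:
  "ideal_N [^]\<^bsub>ideals_set assoc_A\<^esub> (n::nat) \<subseteq> {p \<in> carrier assoc_A. order_ge n p}"
proof (induction n)
  case 0
  then show ?case by (simp add: ideals_set_def nat_pow_def)
next
  case (Suc n)
  show ?case
  proof
    fix p :: "'a assoc"
    assume "p \<in> ideal_N [^]\<^bsub>ideals_set assoc_A\<^esub> Suc n"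
    then have "p \<in> ideal_prod assoc_A (ideal_N [^]\<^bsub>ideals_set assoc_A\<^esub> n) ideal_N"
      by (simp only: ideal_N_pow_Suc)
    then show "p \<in> {p \<in> carrier assoc_A. order_ge (Suc n) p}"
    proof induction
      case (prod i j)
      then have "i \<in> carrier assoc_A" "order_ge n i" "j \<in> carrier assoc_A" "order_ge 1 j"
        using Suc ideal_N_order by blast+
      then show ?case
        using order_ge_mult[of n i 1 j] carrier_assoc_mult[of i "{1, 2}" j]
        by (simp add: assoc_algebra_def Suc_eq_plus1 del: add_Suc_right)
    next
      case (sum p q)
      then show ?case
        using carrier_assoc_add[of p "{1, 2}" q] by (simp add: assoc_algebra_def order_ge_add)
    qed
  qed
qed

lemma additive_subgroup_sum:
  assumes "additive_subgroup J (assoc_algebra X)" "\<And>i. i \<in> S \<Longrightarrow> f i \<in> J"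
  shows "sum f S \<in> J"
  using assms(2)
proof (induction S rule: infinite_finite_induct)
  case (insert i S)
  then show ?case
    using additive_subgroup.a_closed[OF assms(1), of "f i" "sum f S"] by (simp add: assoc_algebra_def)
qed (use additive_subgroup.zero_closed[OF assms(1)] in \<open>simp_all add: assoc_algebra_def\<close>)

text \<open>A word of length at least \<open>Suc m\<close> is a word of length at least
  \<open>m\<close> followed by a letter, so induction puts its monomials into the power. An element
  of order at least \<open>n\<close> is a sum of such monomials.\<close>

lemma order_ge_ideal_N_pow:
  assumes "p \<in> carrier assoc_A" "order_ge n p"
  shows "p \<in> ideal_N [^]\<^bsub>ideals_set assoc_A\<^esub> (n::nat)"
proof -
  have word: "Poly_Mapping.single w c \<in> ideal_N [^]\<^bsub>ideals_set assoc_A\<^esub> m"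
    if "w \<in> lists {1, 2}" "m \<le> length w" for w and c :: 'a and m
    using that
  proof (induction m arbitrary: w c)
    case 0
    then show ?case by (simp add: ideals_set_def nat_pow_def) (simp add: assoc_algebra_def)
  next
    case (Suc m)
    then obtain v i where w: "w = v @ [i]" by (cases w rule: rev_cases) auto
    have "Poly_Mapping.single v c \<in> ideal_N [^]\<^bsub>ideals_set assoc_A\<^esub> m"
      using Suc w by auto
    moreover have "gen i \<in> ideal_N"
      using Suc.prems w ring.genideal_self[OF ring_assoc_algebra, of "{x1, x2}" "{1, 2}"]
      by (auto simp: ideal_N_def gen_carrier)
    ultimately have "Poly_Mapping.single v c * gen i \<in>
        ideal_prod assoc_A (ideal_N [^]\<^bsub>ideals_set assoc_A\<^esub> m) ideal_N"
      using ideal_prod.prod[of "Poly_Mapping.single v c" _ "gen i" _ assoc_A]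
      by (simp add: assoc_algebra_def)
    then show ?case
      unfolding ideal_N_pow_Suc by (simp add: gen_def mult_single w plus_list_def)
  qed
  have "(\<Sum>w\<in>Poly_Mapping.keys p. Poly_Mapping.single w (Poly_Mapping.lookup p w))
      \<in> ideal_N [^]\<^bsub>ideals_set assoc_A\<^esub> n"
  proof (rule additive_subgroup_sum[OF ideal.axioms(1)[OF ideal_N_pow]])
    fix w assume "w \<in> Poly_Mapping.keys p"
    then show "Poly_Mapping.single w (Poly_Mapping.lookup p w) \<in> ideal_N [^]\<^bsub>ideals_set assoc_A\<^esub> n"
      using assms by (intro word) (auto simp: assoc_algebra_def order_ge_def in_keys_iff not_less)
  qed
  then show ?thesis using poly_mapping_sum_single[of p] by simp
qed

lemma ideal_I_generators: "{t_elem lam} \<union> ideal_N [^]\<^bsub>ideals_set assoc_A\<^esub> (6::nat) \<subseteq> ideal_I lam"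
  unfolding ideal_I_def
  by (rule ring.genideal_self[OF ring_assoc_algebra])
    (use additive_subgroup.a_subset[OF ideal.axioms(1)[OF ideal_N_pow]] t_elem_carrier in auto)

lemma t_elem_in_ideal_I: "t_elem lam \<in> ideal_I lam"
  using ideal_I_generators[of lam] by simp

lemma order_ge_6_in_ideal_I: "\<lbrakk>p \<in> carrier assoc_A; order_ge 6 p\<rbrakk> \<Longrightarrow> p \<in> ideal_I lam"
  using order_ge_ideal_N_pow[of p 6] ideal_I_generators[of lam] by blast

text \<open>\<open>t_elem lam\<close> has order at least 5 and \<open>N^6\<close> vanishes below
  degree six. So in degree five the elements of \<open>assoc_A\<close> act only through their
  constant terms, and only multiples of \<open>t_elem lam\<close> arise.\<close>

lemma ideal_I_degree5:
  assumes "p \<in> ideal_I lam"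
  obtains s where "\<And>w. length w = 5 \<Longrightarrow>
    Poly_Mapping.lookup p w = s * Poly_Mapping.lookup (t_elem lam) w"
proof -
  \<comment> \<open>\<open>order_ge 5 p\<close> belongs to the invariant because it makes the
    degree-five coefficients of \<open>a * p\<close> and \<open>p * a\<close> depend only on those
    of \<open>p\<close> and on the constant term of \<open>a\<close>.\<close>
  define J where "J = {p \<in> carrier assoc_A. order_ge 5 p \<and>
    (\<exists>s. \<forall>w. length w = 5 \<longrightarrow> Poly_Mapping.lookup p w = s * Poly_Mapping.lookup (t_elem lam) w)}"
  have "ideal J assoc_A"
  proof (rule ideal_assocI)
    fix p q :: "'a assoc" assume "p \<in> J" "q \<in> J"
    then obtain s s' where "\<forall>w. length w = 5 \<longrightarrow> Poly_Mapping.lookup p w = s * Poly_Mapping.lookup (t_elem lam) w"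
      "\<forall>w. length w = 5 \<longrightarrow> Poly_Mapping.lookup q w = s' * Poly_Mapping.lookup (t_elem lam) w"
      by (auto simp: J_def)
    then have "\<forall>w. length w = 5 \<longrightarrow> Poly_Mapping.lookup (p + q) w = (s + s') * Poly_Mapping.lookup (t_elem lam) w"
      by (simp add: lookup_add distrib_right)
    with \<open>p \<in> J\<close> \<open>q \<in> J\<close> show "p + q \<in> J"
      unfolding J_def by (auto simp: carrier_assoc_add order_ge_add)
  next
    fix a p :: "'a assoc" assume a: "a \<in> carrier assoc_A" and p: "p \<in> J"
    obtain s where s: "\<forall>w. length w = 5 \<longrightarrow> Poly_Mapping.lookup p w = s * Poly_Mapping.lookup (t_elem lam) w"
      and ord: "order_ge 5 p" "p \<in> carrier assoc_A"
      using p by (auto simp: J_def)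
    have "Poly_Mapping.lookup (a * p) w = (Poly_Mapping.lookup a [] * s) * Poly_Mapping.lookup (t_elem lam) w"
      "Poly_Mapping.lookup (p * a) w = (Poly_Mapping.lookup a [] * s) * Poly_Mapping.lookup (t_elem lam) w"
      if "length w = 5" for w
      using that lookup_mult_order[of 0 a 5 p w] lookup_mult_order[of 5 p 0 a w] ord s by simp_all
    then show "a * p \<in> J" "p * a \<in> J"
      using order_ge_mult[of 0 a 5 p] order_ge_mult[of 5 p 0 a] a ord
      unfolding J_def by (auto simp: carrier_assoc_mult)
  next
    show "0 \<in> J"
      by (auto simp: J_def carrier_assoc_zero intro: exI[of _ 0])
  qed (auto simp: J_def)
  moreover have "t_elem lam \<in> J"
    by (auto simp: J_def t_elem_carrier order_ge_t_elem intro: exI[of _ 1])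
  moreover have "ideal_N [^]\<^bsub>ideals_set assoc_A\<^esub> (6::nat) \<subseteq> J"
  proof
    fix p :: "'a assoc" assume "p \<in> ideal_N [^]\<^bsub>ideals_set assoc_A\<^esub> (6::nat)"
    then have "p \<in> carrier assoc_A" "order_ge 6 p"
      using ideal_N_pow_order[of 6] by auto
    then show "p \<in> J"
      by (auto simp: J_def order_ge_def intro: exI[of _ 0])
  qed
  ultimately have "ideal_I lam \<subseteq> J"
    unfolding ideal_I_def by (intro ring.genideal_minimal[OF ring_assoc_algebra]) auto
  with assms that show thesis by (auto simp: J_def)
qed

section \<open>Comparison of coefficients in degree five\<close>

lemma lookup_t_elem:
  "Poly_Mapping.lookup (t_elem lam) [i, j, k, l, m] =
    lam * Poly_Mapping.lookup (lie2 x1 x2) [i, j, k, l, m] + Poly_Mapping.lookup (lie4 x1 x2) [i, j, k, l, m]"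
  by (simp add: t_elem_lie lookup_add lookup_scal)

text \<open>At the words \<open>11122\<close> and \<open>11212\<close>, \<open>e2\<close> has
  coefficients \<open>1\<close> and \<open>- 2\<close>, whereas \<open>t_elem lam\<close> has
  \<open>lam\<close> and \<open>1 - 2 * lam\<close>. A factor \<open>s\<close> would satisfy
  \<open>s * lam = 1\<close> and then \<open>s = 0\<close>.\<close>

lemma e2_notin_ideal_I: "e2 \<notin> ideal_I lam"
proof
  assume "e2 \<in> ideal_I lam"
  then obtain s where s: "\<And>w. length w = 5 \<Longrightarrow>
      Poly_Mapping.lookup e2 w = s * Poly_Mapping.lookup (t_elem lam) w"
    using ideal_I_degree5 by blast
  have e2: "e2 = lie2 x1 x2" by (simp add: e2_def lie2_def)
  have "s * lam = 1"
    using s[of "[1, 1, 1, 2, 2]"] by (simp add: e2 lookup_t_elem lookup_lie order_ge_gen lookup_gen)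
  moreover have "s * (1 - lam * 2) = - 2"
    using s[of "[1, 1, 2, 1, 2]"] by (simp add: e2 lookup_t_elem lookup_lie order_ge_gen lookup_gen)
  moreover have "s * (1 - lam * 2) = s - 2 * (s * lam)" by (simp add: algebra_simps)
  ultimately show False by simp
qed

text \<open>In the application \<mu> is \<open>\<phi> lam\<close>, and \<open>p\<close> is the
  coordinate of a representative of the image of \<open>x_vec\<close>. With
  \<open>\<mu> \<noteq> 0\<close>, coefficients of \<open>lie2 a b\<close> can be read off at words
  missing from \<open>lie4 a b\<close>; \<open>\<mu> \<noteq> lam\<close> refutes the last
  case.\<close>

lemma lie2_mult_in_ideal_I:
  assumes a: "a \<in> free_lie_carrier {1, 2}" and b: "b \<in> free_lie_carrier {1, 2}"
    and p: "p \<in> carrier assoc_A"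
    and in_I: "(scal \<mu> (lie2 a b) + lie4 a b) * p \<in> ideal_I lam"
    and \<mu>: "\<mu> \<noteq> 0" "\<mu> \<noteq> lam"
  shows "lie2 a b * p \<in> ideal_I lam"
proof -
  have ord: "order_ge 1 a" "order_ge 1 b"
    using a b by (auto intro: order_ge_free_lie)
  have ac: "a \<in> carrier assoc_A" "b \<in> carrier assoc_A"
    using a b free_lie_subset by blast+
  have carr: "lie2 a b \<in> carrier assoc_A"
    by (simp add: lie2_def commutator_def carrier_assoc_diff carrier_assoc_mult ac)
  let ?v = "Poly_Mapping.lookup p []"
  define a1 a2 b1 b2 where "a1 = Poly_Mapping.lookup a [1]" and "a2 = Poly_Mapping.lookup a [2]"
    and "b1 = Poly_Mapping.lookup b [1]" and "b2 = Poly_Mapping.lookup b [2]"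
  note ab = a1_def[symmetric] a2_def[symmetric] b1_def[symmetric] b2_def[symmetric]
  obtain s where s: "\<And>w. length w = 5 \<Longrightarrow>
      Poly_Mapping.lookup ((scal \<mu> (lie2 a b) + lie4 a b) * p) w = s * Poly_Mapping.lookup (t_elem lam) w"
    using ideal_I_degree5[OF in_I] by blast
  have "Poly_Mapping.lookup ((scal \<mu> (lie2 a b) + lie4 a b) * p) w =
      (\<mu> * Poly_Mapping.lookup (lie2 a b) w + Poly_Mapping.lookup (lie4 a b) w) * ?v"
    if "length w = 5" for w
    using lookup_mult_order[of 5 "scal \<mu> (lie2 a b) + lie4 a b" 0 p w] that
    by (simp add: order_ge_add order_ge_scal order_ge_lie2 order_ge_lie4 ord lookup_add lookup_scal)
  with s have eq: "(\<mu> * Poly_Mapping.lookup (lie2 a b) w + Poly_Mapping.lookup (lie4 a b) w) * ?v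
      = s * Poly_Mapping.lookup (t_elem lam) w" if "length w = 5" for w
    using that by metis
  \<comment> \<open>The second condition says that the linear parts of \<open>a\<close> and
    \<open>b\<close> are dependent. The first two cases lead to order 6, the third to a
    contradiction.\<close>
  consider "?v = 0" | "a1 * b2 = b1 * a2" | "?v \<noteq> 0" "a1 * b2 \<noteq> b1 * a2" by blast
  then show ?thesis
  proof cases
    case 1
    then have "order_ge 1 p" by (simp add: order_ge_def)
    then have "order_ge 6 (lie2 a b * p)"
      using order_ge_mult[OF order_ge_lie2[OF ord], of 1 p] by simp
    then show ?thesis
      by (simp add: order_ge_6_in_ideal_I carr carrier_assoc_mult p)
  next
    case 2
    \<comment> \<open>Every degree-five coefficient of \<open>lie2 a b\<close> is built from the
      minors \<open>c2 a b i j\<close> of the linear parts.\<close>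
    then have c2_0: "c2 a b i j = 0" if "i \<in> {1, 2}" "j \<in> {1, 2}" for i j
      using that by (auto simp: c2_def a1_def a2_def b1_def b2_def mult.commute)
    have "Poly_Mapping.lookup (lie2 a b) w = 0" if "length w = 5" for w
    proof (cases "w \<in> lists {1, 2}")
      case True
      obtain i j k l m where w: "w = [i, j, k, l, m]"
        using \<open>length w = 5\<close> by (auto simp: numeral_eq_Suc length_Suc_conv)
      with True have "i \<in> {1, 2}" "j \<in> {1, 2}" "k \<in> {1, 2}" "l \<in> {1, 2}" "m \<in> {1, 2}" by auto
      then show ?thesis
        unfolding w lookup_lie2[OF ord] by (simp add: c4_def c3_def c2_0 del: insert_iff)
    next
      case False
      then show ?thesis using carr by (auto simp: assoc_algebra_def in_keys_iff)
    qed
    then have "order_ge 6 (lie2 a b)"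
      using order_ge_lie2[OF ord] order_ge_Suc[of 5 "lie2 a b"] by simp
    then show ?thesis
      by (simp add: order_ge_6_in_ideal_I carr ideal_I_mult2 p)
  next
    case 3
    note coeffs = lookup_t_elem lookup_lie ord order_ge_gen lookup_gen ab
    \<comment> \<open>The words \<open>11112\<close>, \<open>22221\<close>, \<open>11222\<close> and \<open>11122\<close> do not occur in \<open>lie4 a b\<close>.\<close>
    let ?D = "a1 * b2 - b1 * a2"
    have D: "?D \<noteq> 0" using 3 by simp
    \<comment> \<open>\<open>t_elem lam\<close> has degree 3 in \<open>x1\<close> and 2 in
      \<open>x2\<close>, so \<open>11112\<close>, \<open>22221\<close> and \<open>11222\<close> do
      not occur in it either. At \<open>11112\<close> the coefficient of \<open>lie2 a b\<close> is
      \<open>- (a1 * a1 * b1 * ?D)\<close>, so this product vanishes.\<close>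
    have "\<mu> * (a1 * a1 * b1) * ?D * ?v = 0"
      using eq[of "[1, 1, 1, 1, 2]"] by (simp add: coeffs)
    then have ab1: "a1 = 0 \<or> b1 = 0" using 3 \<mu> D by simp
    have "\<mu> * (a2 * a2 * b2) * ?D * ?v = 0"
      using eq[of "[2, 2, 2, 2, 1]"] by (simp add: coeffs) (metis mult.commute)
    then have ab2: "a2 = 0 \<or> b2 = 0" using 3 \<mu> D by simp
    \<comment> \<open>Otherwise the linear parts would be multiples of the swapped generators
      \<open>x2\<close> and \<open>x1\<close>. But \<open>lie2 x2 x1\<close> contains
      \<open>11222\<close>.\<close>
    have "a1 \<noteq> 0"
    proof
      assume [simp]: "a1 = 0"
      then have "b2 = 0" using ab2 D by auto
      then have "\<mu> * (a2 * a2 * b1) * ?D * ?v = 0"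
        using eq[of "[1, 1, 2, 2, 2]"] by (auto simp: coeffs)
      then show False using 3 \<mu> D by simp
    qed
    then have 0: "b1 = 0" "a2 = 0" using ab1 ab2 D by auto
    \<comment> \<open>The linear parts are now multiples of \<open>x1\<close> and \<open>x2\<close>.
      Since \<open>lie2\<close> and \<open>lie4\<close> both have degree 3 in the first argument and
      2 in the second, both acquire the factor \<open>c\<close>: in degree five, \<open>c\<close>
      times \<open>\<mu> e2 + e4\<close> equals \<open>s\<close> times
      \<open>lam e2 + e4\<close>.\<close>
    define c where "c = a1 * a1 * a1 * b2 * b2 * ?v"
    have lie2_coeff: "c * \<mu> = s * lam"
      using eq[of "[1, 1, 1, 2, 2]"] by (simp add: c_def coeffs 0 mult_ac)
    have "c * (1 - 2 * \<mu>) = s * (1 - 2 * lam)"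
      using eq[of "[1, 1, 2, 1, 2]"] by (simp add: c_def coeffs 0 algebra_simps)
    then have "c - 2 * (c * \<mu>) = s - 2 * (s * lam)" by (simp add: algebra_simps)
    then have "c = s" using lie2_coeff by simp
    then have "c * (\<mu> - lam) = 0" using lie2_coeff by (simp add: algebra_simps)
    then show ?thesis using 3 \<mu> D 0 by (simp add: c_def)
  qed
qed


section \<open>The quotient map\<close>

definition proj_lie :: "'k::field \<Rightarrow> 'k assoc \<Rightarrow> 'k assoc set" where
  "proj_lie lam a = (Inl -` congruence_of F_rep (Q_sub lam)) `` {a}"

definition proj_vec :: "'k::field \<Rightarrow> (nat \<Rightarrow>\<^sub>0 'k assoc) \<Rightarrow> (nat \<Rightarrow>\<^sub>0 'k assoc) set" where
  "proj_vec lam v = (Inr -` congruence_of F_rep (Q_sub lam)) `` {v}"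

lemma F_rep_simps:
  "carrier (lie F_rep) = free_lie_carrier {1, 2}" "lzero (lie F_rep) = 0" "lneg (lie F_rep) = uminus"
  "ladd (lie F_rep) = (+)" "lscale (lie F_rep) = scal" "bracket (lie F_rep) = commutator"
  "vec F_rep = free_module {1, 2} {1}" "lzero (free_module X Y) = 0" "lneg (free_module X Y) = uminus"
  "ladd (free_module X Y) = (+)" "lscale (free_module X Y) = (\<lambda>c. Poly_Mapping.map (scal c))"
  "act F_rep = module_act"
  by (simp_all add: F_rep_def free_rep_def free_lie_def free_module_def)

lemma equiv_congruence_F_lie:
  "equiv (free_lie_carrier {1, 2}) (Inl -` congruence_of F_rep (Q_sub lam))"
  by (auto simp: equiv_def refl_on_def sym_on_def trans_on_def congruence_F_lie)

lemma equiv_congruence_F_vec: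
  "equiv (carrier (free_module {1, 2} {1})) (Inr -` congruence_of F_rep (Q_sub lam))"
proof (rule equivI)
  show "sym (Inr -` congruence_of F_rep (Q_sub lam))"
    using ideal_I_uminus[of "_ - _" lam] by (fastforce simp: sym_on_def congruence_F_vec)
  show "trans (Inr -` congruence_of F_rep (Q_sub lam))"
  proof (rule transI)
    fix x y z assume "(x, y) \<in> Inr -` congruence_of F_rep (Q_sub lam)"
      "(y, z) \<in> Inr -` congruence_of F_rep (Q_sub lam)"
    then show "(x, z) \<in> Inr -` congruence_of F_rep (Q_sub lam)"
      using ideal_I_add[of "Poly_Mapping.lookup x 1 - Poly_Mapping.lookup y 1" lam
          "Poly_Mapping.lookup y 1 - Poly_Mapping.lookup z 1"]
      by (simp add: congruence_F_vec)
  qed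
qed (auto simp: refl_on_def congruence_F_vec ideal_I_zero)

lemma zero_in_free_module: "0 \<in> carrier (free_module X Y)"
  by (simp add: free_module_def carrier_assoc_zero)

lemma proj_vec_eq_0_iff:
  assumes "v \<in> carrier (free_module {1, 2} {1})"
  shows "proj_vec lam v = proj_vec lam 0 \<longleftrightarrow> Poly_Mapping.lookup v 1 \<in> ideal_I lam"
  using assms unfolding proj_vec_def
  by (subst eq_equiv_class_iff[OF equiv_congruence_F_vec])
    (simp_all add: congruence_F_vec zero_in_free_module)

lemma proj_hom: "(proj_lie lam, proj_vec lam) \<in> rep_hom F_rep (H_rep lam)"
  unfolding H_rep_def proj_lie_def [abs_def] proj_vec_def [abs_def]
proof (rule rep_quot_lie_rep(1)[OF lie_rep_F_rep])
  let ?T = "congruence_of F_rep (Q_sub lam)"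
  let ?l = "\<lambda>v. Poly_Mapping.lookup v 1"
  have rep: "lie_rep (F_rep :: ('a, 'a assoc, nat \<Rightarrow>\<^sub>0 'a assoc) lie_rep)" by (rule lie_rep_F_rep)
  note l = lie_rep.lie[OF rep] and v = lie_rep.vec[OF rep]
  note l0 = lie_algebra.axioms(1)[OF l]
  note l_closed = linear_space.neg_closed[OF l0] linear_space.add_closed[OF l0]
    linear_space.scale_closed[OF l0] lie_algebra.bracket_closed[OF l]
  note v_closed = linear_space.neg_closed[OF v] linear_space.add_closed[OF v]
    linear_space.scale_closed[OF v] lie_rep.act_closed[OF rep]
  show "Inl (lneg (lie F_rep) a, lneg (lie F_rep) b) \<in> ?T" if "Inl (a, b) \<in> ?T" for a b
    using that l_closed by (auto simp: congruence_F_lie F_rep_simps)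
  show "Inl (lscale (lie F_rep) r a, lscale (lie F_rep) r b) \<in> ?T" if "Inl (a, b) \<in> ?T" for r a b
    using that l_closed by (auto simp: congruence_F_lie F_rep_simps)
  show "Inl (ladd (lie F_rep) a c, ladd (lie F_rep) b d) \<in> ?T"
    and "Inl (bracket (lie F_rep) a c, bracket (lie F_rep) b d) \<in> ?T"
    if "Inl (a, b) \<in> ?T" "Inl (c, d) \<in> ?T" for a b c d
    using that l_closed by (auto simp: congruence_F_lie F_rep_simps)
  show "Inr (lneg (vec F_rep) a, lneg (vec F_rep) b) \<in> ?T" if "Inr (a, b) \<in> ?T" for a b
    using that v_closed ideal_I_uminus[of "?l a - ?l b" lam]
    by (simp add: congruence_F_vec F_rep_simps)
  show "Inr (lscale (vec F_rep) r a, lscale (vec F_rep) r b) \<in> ?T" if "Inr (a, b) \<in> ?T" for r a b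
    using that v_closed ideal_I_scal[of "?l a - ?l b" lam r]
    by (simp add: congruence_F_vec F_rep_simps lookup_scal_map scal_diff)
  show "Inr (ladd (vec F_rep) a c, ladd (vec F_rep) b d) \<in> ?T"
    if "Inr (a, b) \<in> ?T" "Inr (c, d) \<in> ?T" for a b c d
    using that v_closed ideal_I_add[of "?l a - ?l b" lam "?l c - ?l d"]
    by (simp add: congruence_F_vec F_rep_simps lookup_add algebra_simps)
  \<comment> \<open>On the Lie sort the congruence is equality, so \<open>a = b\<close>, and it
    suffices that \<open>ideal_I lam\<close> is a left ideal.\<close>
  show "Inr (act F_rep a v, act F_rep b w) \<in> ?T"
    if "Inl (a, b) \<in> ?T" "Inr (v, w) \<in> ?T" for a b v w
    using that v_closed free_lie_subset[of "{1, 2}"] ideal_I_mult[of a "?l v - ?l w" lam]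
    by (auto simp: congruence_F_vec congruence_F_lie F_rep_simps lookup_module_act right_diff_distrib)
qed (simp_all add: F_rep_simps equiv_congruence_F_lie equiv_congruence_F_vec)

section \<open>Homomorphisms into the twisted representation\<close>

lemma proj_onto:
  shows "h \<in> carrier (lie (H_rep lam)) \<Longrightarrow> \<exists>a\<in>free_lie_carrier {1, 2}. h = proj_lie lam a"
    and "u \<in> carrier (vec (H_rep lam)) \<Longrightarrow> \<exists>v\<in>carrier (free_module {1, 2} {1}). u = proj_vec lam v"
  by (auto simp: H_rep_def rep_quot_def lie_quot_def linear_quot_def quotient_def
      linear_space.defs lie_algebra.defs F_rep_simps proj_lie_def proj_vec_def)

text \<open>The twist keeps bracket and action, so after lifting the images of the generators to
  \<open>a\<close>, \<open>b\<close>, \<open>v\<close> the values of \<open>e2\<close> and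
  \<open>e4\<close> are computed as in \<open>H_rep lam\<close>. Only the scalar \<open>lam\<close>
  changes, into \<open>\<phi> lam\<close>.\<close>

lemma twist_hom_kernel:
  assumes "(f, g) \<in> rep_hom F_rep (twist \<phi> (H_rep lam))"
    and ker: "g (module_act (t_elem lam) x_vec) = g 0"
    and \<phi>: "\<phi> lam \<noteq> 0" "\<phi> lam \<noteq> lam"
  shows "g (module_act e2 x_vec) = g 0"
proof -
  let ?L = "free_lie_carrier {1, 2} :: 'a assoc set"
    and ?V = "carrier (free_module {1, 2} {1}) :: (nat \<Rightarrow>\<^sub>0 'a assoc) set"
  have f: "f p \<in> carrier (lie (H_rep lam))"
    "f (commutator p q) = bracket (lie (H_rep lam)) (f p) (f q)" if "p \<in> ?L" "q \<in> ?L" for p q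
    using assms(1) that by (auto simp: rep_hom_def lie_hom_def linear_hom_def F_rep_simps twist_def)
  have g: "g u \<in> carrier (vec (H_rep lam))" "g 0 = lzero (vec (H_rep lam))"
    "g (u + v) = ladd (vec (H_rep lam)) (g u) (g v)"
    "g (Poly_Mapping.map (scal c) u) = lscale (vec (H_rep lam)) (\<phi> c) (g u)"
    "p \<in> ?L \<Longrightarrow> g (module_act p u) = act (H_rep lam) (f p) (g u)"
    if "u \<in> ?V" "v \<in> ?V" for u v c p
    using assms(1) that by (auto simp: rep_hom_def linear_hom_def F_rep_simps twist_def)
  have pl: "proj_lie lam (commutator p q) = bracket (lie (H_rep lam)) (proj_lie lam p) (proj_lie lam q)"
    if "p \<in> ?L" "q \<in> ?L" for p q
    using proj_hom[of lam] that by (auto simp: rep_hom_def lie_hom_def F_rep_simps)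
  have pv: "proj_vec lam 0 = lzero (vec (H_rep lam))"
    "proj_vec lam (u + v) = ladd (vec (H_rep lam)) (proj_vec lam u) (proj_vec lam v)"
    "proj_vec lam (Poly_Mapping.map (scal c) u) = lscale (vec (H_rep lam)) c (proj_vec lam u)"
    "p \<in> ?L \<Longrightarrow> proj_vec lam (module_act p u) = act (H_rep lam) (proj_lie lam p) (proj_vec lam u)"
    if "u \<in> ?V" "v \<in> ?V" for u v c p
    using proj_hom[of lam] that by (auto simp: rep_hom_def linear_hom_def F_rep_simps)
  have x: "x_vec \<in> ?V"
    by (auto simp: x_vec_def free_module_def lookup_single when_def carrier_assoc_one carrier_assoc_zero)
  have gens: "x1 \<in> ?L" "x2 \<in> ?L" by (auto intro: free_lie_carrier.gen)
  obtain a b v where a: "a \<in> ?L" "f x1 = proj_lie lam a" and b: "b \<in> ?L" "f x2 = proj_lie lam b"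
    and v: "v \<in> ?V" "g x_vec = proj_vec lam v"
    using proj_onto(1)[OF f(1)[OF gens(1) gens(1)]] proj_onto(1)[OF f(1)[OF gens(2) gens(2)]]
      proj_onto(2)[OF g(1)[OF x x]] by blast
  note comm = free_lie_carrier.commutator
  have L: "lie2 p q \<in> ?L" "lie4 p q \<in> ?L" if "p \<in> ?L" "q \<in> ?L" for p q
    using that by (simp_all add: lie2_def lie4_def comm)
  have lie: "f (lie2 x1 x2) = proj_lie lam (lie2 a b)" "f (lie4 x1 x2) = proj_lie lam (lie4 a b)"
    using a b gens by (simp_all add: lie2_def lie4_def comm f pl)
  have V: "module_act p u \<in> ?V" "Poly_Mapping.map (scal c) u \<in> ?V" "0 \<in> ?V" "u + w \<in> ?V"
    if "p \<in> ?L" "u \<in> ?V" "w \<in> ?V" for p u w c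
    using lie_rep.act_closed[OF lie_rep_F_rep, of p u]
      linear_space.scale_closed[OF linear_space_free_module, of u]
      linear_space.zero_closed[OF linear_space_free_module[of "{1, 2}" "{1}"]]
      linear_space.add_closed[OF linear_space_free_module, of u _ _ w] that
    by (simp_all add: F_rep_simps)
  \<comment> \<open>\<open>w\<close> represents the image of
    \<open>module_act (t_elem lam) x_vec\<close>. The scalar is \<open>\<phi> lam\<close> because
    \<open>g\<close> maps to the twist, while \<open>proj_vec lam\<close> maps to the untwisted
    representation.\<close>
  define w where "w = Poly_Mapping.map (scal (\<phi> lam)) (module_act (lie2 a b) v) + module_act (lie4 a b) v"
  \<comment> \<open>The scalar is moved from the Lie element to the vector sort, where the linearity
    of \<open>g\<close> applies.\<close>
  have "module_act (t_elem lam) x_vec =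
      Poly_Mapping.map (scal lam) (module_act (lie2 x1 x2) x_vec) + module_act (lie4 x1 x2) x_vec"
    by (rule poly_mapping_eqI)
      (simp add: lookup_module_act lookup_add lookup_scal_map t_elem_lie distrib_right scal_mult)
  then have "g (module_act (t_elem lam) x_vec) = proj_vec lam w"
    using a b v gens x by (simp add: g pv L V lie w_def)
  then have "proj_vec lam w = proj_vec lam 0"
    using ker by (simp add: g(2)[OF x x] pv(1)[OF x x])
  moreover have "w \<in> ?V" using a b v by (simp add: w_def V L)
  moreover have "Poly_Mapping.lookup w 1 = (scal (\<phi> lam) (lie2 a b) + lie4 a b) * Poly_Mapping.lookup v 1"
    by (simp add: w_def lookup_module_act lookup_add lookup_scal_map distrib_right scal_mult)
  ultimately have "(scal (\<phi> lam) (lie2 a b) + lie4 a b) * Poly_Mapping.lookup v 1 \<in> ideal_I lam"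
    by (simp add: proj_vec_eq_0_iff)
  then have "lie2 a b * Poly_Mapping.lookup v 1 \<in> ideal_I lam"
    using a b v \<phi> by (intro lie2_mult_in_ideal_I) (auto simp: free_module_def)
  then have "proj_vec lam (module_act (lie2 a b) v) = proj_vec lam 0"
    using a b v by (subst proj_vec_eq_0_iff) (simp_all add: V L lookup_module_act)
  moreover have "g (module_act (lie2 x1 x2) x_vec) = proj_vec lam (module_act (lie2 a b) v)"
    using a b v gens x by (simp add: g pv L lie)
  moreover have "(e2 :: 'a assoc) = lie2 x1 x2" by (simp add: e2_def lie2_def)
  ultimately show ?thesis by (simp add: g(2)[OF x x] pv(1)[OF x x])
qed

lemma not_geometrically_equivalent_twist:
  assumes \<phi>: "\<phi> lam \<noteq> 0" "\<phi> lam \<noteq> lam"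
  shows "\<not> geometrically_equivalent (H_rep lam) (twist \<phi> (H_rep lam))"
proof
  assume geq: "geometrically_equivalent (H_rep lam) (twist \<phi> (H_rep lam))"
  define T :: "('a assoc \<times> 'a assoc + (nat \<Rightarrow>\<^sub>0 'a assoc) \<times> (nat \<Rightarrow>\<^sub>0 'a assoc)) set"
    where "T = {Inr (module_act (t_elem lam) x_vec, 0)}"
  have V: "Poly_Mapping.single 1 p \<in> carrier (free_module {1, 2} {1})"
    if "p \<in> carrier assoc_A" for p :: "'a assoc"
    using that by (auto simp: free_module_def lookup_single when_def carrier_assoc_zero)
  have e2: "(e2 :: 'a assoc) \<in> carrier assoc_A"
    by (simp add: e2_def commutator_def carrier_assoc_diff carrier_assoc_mult gen_carrier)
  note V' = V[OF t_elem_carrier] V[OF e2] zero_in_free_module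
  have "T \<subseteq> sort_squares F_rep"
    using V' by (simp add: T_def sort_squares_def F_rep_simps module_act_x_vec image_iff)
  then have "alg_closure F_rep (H_rep lam) T = alg_closure F_rep (twist \<phi> (H_rep lam)) T"
    using geq unfolding geometrically_equivalent_def F_rep_def by simp
  moreover have "Inr (module_act e2 x_vec, 0) \<in> alg_closure F_rep (twist \<phi> (H_rep lam)) T"
    unfolding alg_closure_def
  proof clarify
    fix f :: "'a assoc \<Rightarrow> 'a assoc set" and g :: "(nat \<Rightarrow>\<^sub>0 'a assoc) \<Rightarrow> (nat \<Rightarrow>\<^sub>0 'a assoc) set"
    assume fg: "(f, g) \<in> rep_hom F_rep (twist \<phi> (H_rep lam))" and "T \<subseteq> hom_kernel F_rep (f, g)"
    then have "g (module_act (t_elem lam) x_vec) = g 0"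
      by (auto simp: T_def hom_kernel_def)
    then have "g (module_act e2 x_vec) = g 0"
      by (rule twist_hom_kernel[OF fg _ \<phi>])
    then show "Inr (module_act e2 x_vec, 0) \<in> hom_kernel F_rep (f, g)"
      using V' by (simp add: hom_kernel_def F_rep_simps module_act_x_vec image_iff)
  qed
  \<comment> \<open>The projection thus belongs to the family intersected in the closure over
    \<open>H_rep lam\<close>, which therefore cannot contain a pair separated by it.\<close>
  moreover have "T \<subseteq> hom_kernel F_rep (proj_lie lam, proj_vec lam)"
    using V' by (simp add: T_def hom_kernel_def F_rep_simps module_act_x_vec image_iff
        proj_vec_eq_0_iff t_elem_in_ideal_I)
  ultimately have "Inr (module_act e2 x_vec, 0) \<in> hom_kernel F_rep (proj_lie lam, proj_vec lam)"
    using proj_hom[of lam] unfolding alg_closure_def by blast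
  then have "proj_vec lam (module_act e2 x_vec) = proj_vec lam 0"
    by (auto simp: hom_kernel_def)
  then show False
    using V' e2_notin_ideal_I[of lam] by (simp add: module_act_x_vec proj_vec_eq_0_iff)
qed

end

theorem proposition5p10:
  fixes \<phi> :: "'k::field_char_0 \<Rightarrow> 'k" and lam :: 'k
  assumes "field_automorphism \<phi>" and "\<phi> \<noteq> id" and "\<phi> lam \<noteq> lam"
  shows "\<not> geometrically_equivalent (H_rep lam) (twist \<phi> (H_rep lam))"
proof (rule not_geometrically_equivalent_twist)
  \<comment> \<open>By injectivity and \<open>\<phi> 0 = 0\<close>, a zero value would force
    \<open>lam = 0\<close>, a fixed point of \<phi>.\<close>
  show "\<phi> lam \<noteq> 0"
  proof
    assume "\<phi> lam = 0"
    moreover have "\<phi> 0 = 0"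
      using assms(1) unfolding field_automorphism_def by (metis add.right_neutral add_left_imp_eq)
    ultimately show False
      using assms(1,3) unfolding field_automorphism_def by (metis bij_is_inj injD)
  qed
qed fact

end
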